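(* Let $n\ge1$ and let $\mathcal{L}_n$ be the closed interval $[e,\,[1][2]\cdots[n]]$ of the absolute order $\mathrm{Abs}(B_n)$ (a lattice). Then: (i) The number of elements of $\mathcal{L}_n$ is $\displaystyle\sum_{k=0}^{\lfloor n/2\rfloor}\binom{n}{2k}2^{n-k}(2k-1)!!$. (ii) The number of elements of $\mathcal{L}_n$ of rank $r$ is $\displaystyle\sum_{k=0}^{\min\{r,n-r\}}\frac{n!}{k!\,(r-k)!\,(n-r-k)!}$. (iii) The zeta polynomial $Z_n$ of $\mathcal{L}_n$ is $\displaystyle Z_n(m)=\sum_{k=0}^{\lfloor n/2\rfloor}\binom{n}{2k}m^{n-k}(m-1)^k(2k-1)!!$. (iv) The number of maximal chains of $\mathcal{L}_n$ is $\displaystyle n!\sum_{k=0}^{\lfloor n/2\rfloor}\binom{n}{2k}(2k-1)!!$. (v) The Möbius function $\mu_n$ of $\mathcal{L}_n$ satisfies $\displaystyle\mu_n(\hat0,\hat1)=(-1)^n\sum_{k=0}^{\lfloor n/2\rfloor}\binom{n}{2k}2^k(2k-1)!!$, where $\hat0$ and $\hat1$ are the minimum and maximum elements of $\mathcal{L}_n$.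
   Context: Hyperoctahedral group: $B_n$ is the group of permutations $w$ of $\{\pm1,\dots,\pm n\}$ with $w(-i)=-w(i)$ for all $i$; $e$ is the identity. The paired $2$-cycle $(\!(a,b)\!)$ is the permutation with cycle form $(a\,b)(-a\,-b)$, and $[i]$ is the transposition $(i\,-i)$. The reflections of $B_n$ are $\mathcal{T}=\{[i]:1\le i\le n\}\cup\{(\!(i,j)\!),(\!(i,-j)\!):1\le i<j\le n\}$. Absolute order: the absolute length $\ell_{\mathcal T}(w)$ is the least $k$ such that $w$ is a product of $k$ elements of $\mathcal T$; $\mathrm{Abs}(B_n)$ is the partial order on $B_n$ given by $u\preceq v$ iff $\ell_{\mathcal T}(u)+\ell_{\mathcal T}(u^{-1}v)=\ell_{\mathcal T}(v)$; it is graded with rank function $\ell_{\mathcal T}$. $(2m-1)!!=1\cdot3\cdots(2m-1)$ for positive integers $m$, and $(2\cdot0-1)!!=1$. The zeta polynomial $Z(P,m)$ of a finite poset $P$ is the polynomial in $m$ which, for integers $m\ge2$, counts the multichains $x_1\le x_2\le\cdots\le x_{m-1}$ of $P$. *)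

theory Defs
  imports
    "HOL-Combinatorics.Permutations"
    "HOL-Algebra.Lattice"
    "HOL-Computational_Algebra.Polynomial"
begin

section \<open>The hyperoctahedral group and its reflections\<close>

text \<open>Signed permutations are functions on all integers which fix every point outside
  \<open>signed_set n\<close>; the group operation is composition and the identity is \<^term>\<open>id\<close>.\<close>

definition signed_set :: "nat \<Rightarrow> int set" where
  "signed_set n = {- int n..int n} - {0}"

definition hyperoctahedral :: "nat \<Rightarrow> (int \<Rightarrow> int) set" where
  "hyperoctahedral n =
     {w. w permutes signed_set n \<and> (\<forall>i\<in>signed_set n. w (- i) = - w i)}"

definition sign_change :: "int \<Rightarrow> int \<Rightarrow> int" where
  "sign_change i = transpose i (- i)"

definition paired_cycle :: "int \<Rightarrow> int \<Rightarrow> int \<Rightarrow> int" where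
  "paired_cycle a b = transpose a b \<circ> transpose (- a) (- b)"

definition reflections :: "nat \<Rightarrow> (int \<Rightarrow> int) set" where
  "reflections n =
     {sign_change i | i. 1 \<le> i \<and> i \<le> int n} \<union>
     ({paired_cycle i j | i j. 1 \<le> i \<and> i < j \<and> j \<le> int n} \<union>
      {paired_cycle i (- j) | i j. 1 \<le> i \<and> i < j \<and> j \<le> int n})"

definition composition :: "('a \<Rightarrow> 'a) list \<Rightarrow> 'a \<Rightarrow> 'a" where
  "composition ws = foldr (\<circ>) ws id"

definition abs_length :: "nat \<Rightarrow> (int \<Rightarrow> int) \<Rightarrow> nat" where
  "abs_length n w =
     (LEAST k. \<exists>ts. length ts = k \<and> set ts \<subseteq> reflections n \<and> composition ts = w)"


section \<open>The absolute order and the interval below the product of all sign changes\<close>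

definition Abs_order :: "nat \<Rightarrow> (int \<Rightarrow> int) gorder" where
  "Abs_order n =
     \<lparr>carrier = hyperoctahedral n, eq = (=),
      le = (\<lambda>u v. abs_length n u + abs_length n (inv u \<circ> v) = abs_length n v)\<rparr>"

definition all_sign_changes :: "nat \<Rightarrow> int \<Rightarrow> int" where
  "all_sign_changes n = composition (map sign_change [1..int n])"

definition L_interval :: "nat \<Rightarrow> (int \<Rightarrow> int) gorder" where
  "L_interval n =
     (Abs_order n)\<lparr>carrier := \<lbrace>id..all_sign_changes n\<rbrace>\<^bsub>Abs_order n\<^esub>\<rparr>"


section \<open>Invariants of finite posets\<close>

definition multichains :: "'a gorder \<Rightarrow> nat \<Rightarrow> 'a list set" where
  "multichains P l =
     {xs. length xs = l \<and> set xs \<subseteq> carrier P \<and> successively (le P) xs}"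

definition zeta_polynomial :: "'a gorder \<Rightarrow> real poly" where
  "zeta_polynomial P =
     (THE p. \<forall>m\<ge>2. poly p (real m) = real (card (multichains P (m - 1))))"

definition maximal_chains :: "'a gorder \<Rightarrow> 'a set set" where
  "maximal_chains P = {C. pred_on.maxchain (carrier P) (le P) C}"

text \<open>The recursion \<open>\<mu>(x, x) = 1\<close> and \<open>\<mu>(x, y) = - (\<Sum> x \<le> z < y. \<mu>(x, z))\<close> for
  \<open>x < y\<close>. The guard makes it terminate; the value outside finite posets, and for
  \<open>x\<close>, \<open>y\<close> with \<open>x \<le> y\<close> false, is the dummy value \<open>0\<close>.\<close>

function mobius :: "'a gorder \<Rightarrow> 'a \<Rightarrow> 'a \<Rightarrow> int" where
  "mobius P x y =
     (if partial_order P \<and> finite (carrier P) \<and> x \<in> carrier P \<and> y \<in> carrier P \<and> le P x y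
      then if x = y then 1
           else - (\<Sum>z | z \<in> carrier P \<and> le P x z \<and> le P z y \<and> z \<noteq> y. mobius P x z)
      else 0)"
  by pat_completeness auto
termination
proof (relation "Wellfounded.measure (\<lambda>(P, x, y). card {z \<in> carrier P. le P x z \<and> le P z y})",
       goal_cases)
  case 1
  show ?case by simp
next
  case (2 P x y z)
  then interpret partial_order P by simp
  have z: "z \<in> carrier P" "le P x z" "le P z y" "z \<noteq> y"
    and xy: "x \<in> carrier P" "y \<in> carrier P" "le P x y" and fin: "finite (carrier P)"
    using 2 by auto
  have "{w \<in> carrier P. le P x w \<and> le P w z} \<subset> {w \<in> carrier P. le P x w \<and> le P w y}"
  proof (rule psubsetI)
    show "{w \<in> carrier P. le P x w \<and> le P w z} \<subseteq> {w \<in> carrier P. le P x w \<and> le P w y}"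
      using z xy le_trans by blast
    have "\<not> le P y z"
      using z xy le_antisym by blast
    then show "{w \<in> carrier P. le P x w \<and> le P w z} \<noteq> {w \<in> carrier P. le P x w \<and> le P w y}"
      using xy by blast
  qed
  then show ?case
    using fin by (auto intro!: psubset_card_mono)
qed

declare mobius.simps [simp del]


section \<open>Double factorials\<close>

text \<open>\<open>odd_double_fact k\<close> is \<open>(2 k - 1)!!\<close>, with the empty product for \<open>k = 0\<close>.\<close>

definition odd_double_fact :: "nat \<Rightarrow> nat" where
  "odd_double_fact k = (\<Prod>i=1..k. 2 * i - 1)"

end

theory Submission
  imports Defs "HOL-Library.Numeral_Type"
begin

text \<open>An element \<open>u\<close> of the interval satisfies \<open>codim Fix(u) + codim Fix(-u) \<le> n\<close>, so its eigenspaces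
  for \<open>1\<close> and \<open>-1\<close> exhaust everything: the interval consists of the involutions of \<open>B\<^sub>n\<close>, and
  \<open>u\<close> lies below \<open>v\<close> iff each \<open>i\<close> satisfies \<open>v i = - i\<close>, \<open>u i = i\<close> or \<open>u i = v i\<close>. Hence a multichain
  acts on each \<open>i\<close> by fixing it up to some time, pairing it with one and the same partner for a
  while (possibly not at all), and then negating it. Multichains are therefore partial matchings
  of \<open>{1..n}\<close> with labels, and counting these gives the zeta polynomial and the rank sizes. The
  number of maximal chains and the Moebius function are read off the zeta polynomial, as its
  leading coefficient times \<open>n!\<close> and its value at \<open>-1\<close>.\<close>

section \<open>Chains and multichains in finite posets\<close>

text \<open>The involution property is a dimension count: a product of \<open>k\<close> reflections
  has fixed space of codimension at most \<open>k\<close>, and since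
  \<open>c = all_sign_changes n\<close> acts as -1, vectors fixed by \<open>inv u \<circ> c\<close>
  are negated by \<open>u\<close>. Additive lengths therefore leave no room outside the two
  eigenspaces. For involutions no separate lower bound on the length is needed: the obvious words
  for \<open>u\<close> and \<open>u \<circ> c\<close> have total length \<open>n\<close>, the length
  of \<open>c\<close>, so both are reduced. In a multichain of \<open>m - 1\<close> elements an
  unmatched point has \<open>m\<close> possible switching times. A pair has a sign and two distinct
  times out of \<open>m\<close>, hence \<open>m * (m - 1)\<close> labels, so a matching with
  \<open>k\<close> pairs counts \<open>m ^ (n - k) * (m - 1) ^ k\<close> times. Multichains
  determine the zeta polynomial only at integers from 2 on, whereas the Moebius function needs a
  negative argument. The link is made in an arbitrary finite poset, through an interpolation formula
  whose recursion holds at every real number. For maximal chains the poset must also be graded: then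
  no strict chain is longer than the rank allows, and the longest ones are exactly the maximal
  ones.\<close>

locale finite_poset = partial_order P for P :: "'a gorder" (structure) +
  assumes finite_carrier: "finite (carrier P)"
begin

section \<open>Lower sets, and chains and multichains inside them\<close>

definition down :: "'a \<Rightarrow> 'a set" where
  "down y = {z \<in> carrier P. le P z y}"

text \<open>\<open>y\<close> itself is excluded, so that splitting off the largest member of a chain
  leaves a set of the same kind below a smaller element. The numbers of these sets are the
  coefficients of \<open>newton\<close>.\<close>

definition chains_below :: "'a \<Rightarrow> nat \<Rightarrow> 'a set set" where
  "chains_below y k =
     {C. C \<subseteq> down y - {y} \<and> card C = k \<and> (\<forall>a\<in>C. \<forall>b\<in>C. le P a b \<or> le P b a)}"

definition multichains_below :: "'a \<Rightarrow> nat \<Rightarrow> 'a list set" where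
  "multichains_below y l = {xs \<in> multichains P l. set xs \<subseteq> down y}"

lemma down_subset: "down y \<subseteq> carrier P"
  by (auto simp: down_def)

lemma finite_down: "finite (down y)"
  using finite_carrier down_subset finite_subset by blast

lemma self_in_down: "y \<in> carrier P \<Longrightarrow> y \<in> down y"
  by (simp add: down_def)

lemma down_mono: "\<lbrakk>z \<in> down y; y \<in> carrier P\<rbrakk> \<Longrightarrow> down z \<subseteq> down y"
  using le_trans by (auto simp: down_def)

lemma not_in_down: "\<lbrakk>z \<in> down y - {y}; y \<in> carrier P\<rbrakk> \<Longrightarrow> y \<notin> down z"
  using le_antisym by (auto simp: down_def)

lemma down_psubset: "\<lbrakk>z \<in> down y - {y}; y \<in> carrier P\<rbrakk> \<Longrightarrow> down z \<subset> down y"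
  using not_in_down[of z y] down_mono[of z y] self_in_down[of y] by blast

lemma finite_chains_below: "finite (chains_below y k)"
  by (rule finite_subset[of _ "Pow (down y)"]) (auto simp: chains_below_def finite_down)

lemma chains_below_0: "chains_below y 0 = {{}}"
  using finite_down finite_subset by (fastforce simp: chains_below_def)

lemma chains_below_eq_empty:
  assumes "card (carrier P) < k"
  shows "chains_below y k = {}"
proof -
  have "card C \<le> card (carrier P)" if "C \<subseteq> down y - {y}" for C
    using that down_subset[of y] by (intro card_mono finite_carrier) auto
  then show ?thesis
    using assms by (fastforce simp: chains_below_def)
qed

lemma finite_chain_has_max:
  assumes "finite C" "C \<noteq> {}" "C \<subseteq> carrier P" "\<forall>a\<in>C. \<forall>b\<in>C. le P a b \<or> le P b a"
  shows "\<exists>z\<in>C. \<forall>x\<in>C. le P x z"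
  using assms
proof (induction C rule: finite_ne_induct)
  case (insert x C)
  then obtain z where z: "z \<in> C" "\<forall>x\<in>C. le P x z" by auto
  show ?case
  proof (cases "le P x z")
    case True
    then show ?thesis using z by auto
  next
    case False
    then have "le P z x" using insert.prems z by auto
    then have "le P y x" if "y \<in> C" for y
      using that z \<open>le P z x\<close> insert.prems le_trans[of y z x] by blast
    then show ?thesis using insert.prems by auto
  qed
qed auto

text \<open>A nonempty finite chain has exactly one largest member; \<open>z\<close> is that member,
  which also makes the union disjoint when it is counted.\<close>

lemma chains_below_Suc:
  assumes y: "y \<in> carrier P"
  shows "chains_below y (Suc k) = (\<Union>z\<in>down y - {y}. insert z ` chains_below z k)"
proof (intro equalityI subsetI)
  fix C assume C: "C \<in> chains_below y (Suc k)"
  then have sub: "C \<subseteq> down y - {y}" and card: "card C = Suc k"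
    and comp: "\<forall>a\<in>C. \<forall>b\<in>C. le P a b \<or> le P b a"
    by (auto simp: chains_below_def)
  have fin: "finite C" and ne: "C \<noteq> {}"
    using card by (auto intro: card_ge_0_finite)
  obtain z where z: "z \<in> C" "\<forall>x\<in>C. le P x z"
    using finite_chain_has_max[OF fin ne _ comp] sub down_subset by blast
  have "C - {z} \<in> chains_below z k"
    using z sub card comp fin by (auto simp: chains_below_def down_def)
  moreover have "C = insert z (C - {z})" using z by auto
  ultimately show "C \<in> (\<Union>z\<in>down y - {y}. insert z ` chains_below z k)"
    using z sub by blast
next
  fix C assume "C \<in> (\<Union>z\<in>down y - {y}. insert z ` chains_below z k)"
  then obtain z D where z: "z \<in> down y - {y}" and D: "D \<in> chains_below z k"
    and C: "C = insert z D" by auto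
  have D': "D \<subseteq> down z - {z}" "card D = k" "\<forall>a\<in>D. \<forall>b\<in>D. le P a b \<or> le P b a"
    using D by (auto simp: chains_below_def)
  have "finite D" using D' finite_down finite_subset by blast
  moreover have "z \<notin> D" using D' by blast
  ultimately have "card C = Suc k" using D' C by simp
  moreover have "C \<subseteq> down y - {y}"
    using D' C z down_psubset[OF z y] not_in_down[OF z y] by blast
  moreover have "\<forall>a\<in>C. \<forall>b\<in>C. le P a b \<or> le P b a"
  proof -
    have "le P z z" "\<forall>a\<in>D. le P a z" using D' z by (auto simp: down_def)
    then show ?thesis using D' C by auto
  qed
  ultimately show "C \<in> chains_below y (Suc k)"
    by (simp add: chains_below_def)
qed

lemma card_chains_below_Suc:
  assumes y: "y \<in> carrier P"
  shows "card (chains_below y (Suc k)) = (\<Sum>z\<in>down y - {y}. card (chains_below z k))"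
proof -
  have inj: "inj_on (insert z) (chains_below z k)" for z
    by (rule inj_onI) (auto simp: chains_below_def insert_ident)
  have disj: "insert z ` chains_below z k \<inter> insert w ` chains_below w k = {}"
    if "z \<in> down y - {y}" "w \<in> down y - {y}" "z \<noteq> w" for z w
  proof (rule ccontr)
    assume "\<not> ?thesis"
    then obtain D E where "D \<in> chains_below z k" "E \<in> chains_below w k" "insert z D = insert w E"
      by auto
    then have "le P w z" "le P z w"
      using that by (auto simp: chains_below_def down_def)
    then show False
      using that le_antisym by (auto simp: down_def)
  qed
  have "card (chains_below y (Suc k)) = (\<Sum>z\<in>down y - {y}. card (insert z ` chains_below z k))"
    unfolding chains_below_Suc[OF y] using disj
    by (intro card_UN_disjoint) (auto simp: finite_down finite_chains_below)
  then show ?thesis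
    by (simp add: card_image[OF inj])
qed

section \<open>Counting multichains\<close>

lemma finite_multichains_below: "finite (multichains_below y l)"
  by (rule finite_subset[OF _ finite_lists_length_eq[OF finite_carrier, of l]])
     (auto simp: multichains_below_def multichains_def)

lemma multichains_below_0: "multichains_below y 0 = {[]}"
  by (auto simp: multichains_below_def multichains_def)

lemma multichains_eq_sorted:
  "multichains P l = {xs. length xs = l \<and> set xs \<subseteq> carrier P \<and> sorted_wrt (le P) xs}"
proof -
  have "successively (le P) xs \<longleftrightarrow> sorted_wrt (le P) xs" if "set xs \<subseteq> carrier P" for xs
    using that by (intro successively_iff_sorted_wrt_strong) (meson le_trans subsetD)
  then show ?thesis
    unfolding multichains_def by blast
qed

lemma multichain_snoc_iff:
  assumes y: "y \<in> carrier P"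
  shows "xs @ [z] \<in> multichains_below y (Suc l) \<longleftrightarrow> z \<in> down y \<and> xs \<in> multichains_below z l"
proof -
  have "set xs \<subseteq> down y" if "z \<in> down y" "set xs \<subseteq> down z"
    using that down_mono y by blast
  then show ?thesis
    unfolding multichains_below_def multichains_eq_sorted
    by (auto simp: sorted_wrt_append down_def)
qed

lemma card_multichains_below_Suc:
  assumes y: "y \<in> carrier P"
  shows "card (multichains_below y (Suc l)) = (\<Sum>z\<in>down y. card (multichains_below z l))"
proof -
  have "multichains_below y (Suc l) = (\<Union>z\<in>down y. (\<lambda>xs. xs @ [z]) ` multichains_below z l)"
  proof (intro equalityI subsetI)
    fix xs assume xs: "xs \<in> multichains_below y (Suc l)"
    then have "xs \<noteq> []" by (auto simp: multichains_below_def multichains_def)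
    then obtain ys z where "xs = ys @ [z]" by (metis rev_exhaust)
    then show "xs \<in> (\<Union>z\<in>down y. (\<lambda>xs. xs @ [z]) ` multichains_below z l)"
      using xs multichain_snoc_iff[OF y] by auto
  qed (use multichain_snoc_iff[OF y] in auto)
  moreover have "card (\<Union>z\<in>down y. (\<lambda>xs. xs @ [z]) ` multichains_below z l)
      = (\<Sum>z\<in>down y. card ((\<lambda>xs. xs @ [z]) ` multichains_below z l))"
    by (intro card_UN_disjoint) (auto simp: finite_down finite_multichains_below)
  ultimately show ?thesis
    by (simp add: card_image inj_on_def)
qed

text \<open>The polynomial interpolating \<open>l \<mapsto> card (multichains_below y l)\<close>, by Newton's forward
  difference formula: the difference operator turns \<open>y\<close> into the sum over all \<open>z\<close> below \<open>y\<close>.\<close>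

definition newton :: "'a \<Rightarrow> real \<Rightarrow> real" where
  "newton y x = (\<Sum>k\<le>card (carrier P). real (card (chains_below y k)) * (x gchoose k))"

lemma newton_0: "newton y 0 = 1"
  unfolding newton_def by (simp add: gbinomial_0_left if_distrib chains_below_0 cong: if_cong)

text \<open>Pascal's rule turns the difference of \<open>newton y\<close> at \<open>x + 1\<close>
  and \<open>x\<close> into a shift of the coefficients, and splitting off largest members turns the
  shifted coefficients into a sum over the elements strictly below \<open>y\<close>. No integrality
  of \<open>x\<close> enters, so the recursion is available at negative arguments.\<close>

lemma newton_plus1:
  assumes y: "y \<in> carrier P"
  shows "newton y (x + 1) = (\<Sum>z\<in>down y. newton z x)"
proof -
  let ?K = "card (carrier P)"
  let ?s = "\<lambda>y k. real (card (chains_below y k))"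
  have "(\<Sum>z\<in>down y - {y}. newton z x) = (\<Sum>k\<le>?K. (\<Sum>z\<in>down y - {y}. ?s z k) * (x gchoose k))"
    unfolding newton_def by (subst sum.swap) (simp add: sum_distrib_right)
  also have "\<dots> = (\<Sum>k\<le>?K. ?s y (Suc k) * (x gchoose k))"
    by (simp add: card_chains_below_Suc[OF y])
  \<comment> \<open>The summand for \<open>k = ?K\<close> vanishes because no chain has
    \<open>Suc ?K\<close> members; now the index range matches that of the difference computed
    below.\<close>
  also have "\<dots> = (\<Sum>k<?K. ?s y (Suc k) * (x gchoose k))"
    by (simp add: lessThan_Suc_atMost[symmetric] chains_below_eq_empty)
  finally have *: "(\<Sum>z\<in>down y - {y}. newton z x) = (\<Sum>k<?K. ?s y (Suc k) * (x gchoose k))" .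
  have "newton y (x + 1) - newton y x
      = (\<Sum>k\<le>?K. ?s y k * ((x + 1 gchoose k) - (x gchoose k)))"
    by (simp add: newton_def sum_subtractf right_diff_distrib)
  also have "\<dots> = (\<Sum>k<?K. ?s y (Suc k) * (x gchoose k))"
    by (simp add: sum.atMost_shift gbinomial_Suc_Suc)
  finally show ?thesis
    using * sum.remove[OF finite_down self_in_down[OF y], of "\<lambda>z. newton z x"] by simp
qed

lemma card_multichains_below:
  "y \<in> carrier P \<Longrightarrow> real (card (multichains_below y l)) = newton y (real l)"
proof (induction l arbitrary: y)
  case 0
  then show ?case by (simp add: multichains_below_0 newton_0)
next
  case (Suc l)
  have "real (card (multichains_below y (Suc l))) = (\<Sum>z\<in>down y. newton z (real l))"
    using Suc down_subset[of y] by (simp add: card_multichains_below_Suc subset_iff)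
  then show ?case
    using newton_plus1[OF Suc.prems, of "real l"] by (simp add: add.commute)
qed

text \<open>Running the recursion \<open>newton_plus1\<close> backwards: to \<open>-1\<close> it gives the identity of the
  incidence algebra, and to \<open>-2\<close> the inverse of its zeta function.\<close>

lemma newton_minus1:
  assumes bot: "b \<in> carrier P" "\<And>y. y \<in> carrier P \<Longrightarrow> le P b y"
  assumes "y \<in> carrier P"
  shows "newton y (-1) = (if y = b then 1 else 0)"
  using \<open>y \<in> carrier P\<close>
proof (induction "card (down y)" arbitrary: y rule: less_induct)
  case less
  have IH: "newton z (-1) = (if z = b then 1 else 0)" if "z \<in> down y - {y}" for z
    using that less down_subset psubset_card_mono[OF finite_down down_psubset] by blast
  have "b \<in> down y" using bot less.prems by (auto simp: down_def)
  have "1 = (\<Sum>z\<in>down y. newton z (-1))"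
    using newton_plus1[OF less.prems, of "-1"] by (simp add: newton_0)
  also have "\<dots> = newton y (-1) + (\<Sum>z\<in>down y - {y}. if z = b then 1 else 0)"
    using sum.remove[OF finite_down self_in_down[OF less.prems], of "\<lambda>z. newton z (-1)"] IH by simp
  finally show ?case
    using \<open>b \<in> down y\<close> by (auto simp: finite_down split: if_splits)
qed

lemma mobius_eq_newton:
  assumes bot: "b \<in> carrier P" "\<And>y. y \<in> carrier P \<Longrightarrow> le P b y"
  assumes "y \<in> carrier P"
  shows "real_of_int (mobius P b y) = newton y (-2)"
  using \<open>y \<in> carrier P\<close>
proof (induction "card (down y)" arbitrary: y rule: less_induct)
  case less
  have IH: "real_of_int (mobius P b z) = newton z (-2)" if "z \<in> down y - {y}" for z
    using that less down_subset psubset_card_mono[OF finite_down down_psubset] by blast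
  \<comment> \<open>The recursion at \<open>-2\<close>, with the known value at \<open>-1\<close> on
    its left, has the form of the defining recursion of \<open>mobius\<close>.\<close>
  have eq: "(if y = b then 1 else 0) = newton y (-2) + (\<Sum>z\<in>down y - {y}. newton z (-2))"
    using newton_plus1[OF less.prems, of "-2"] newton_minus1[OF bot less.prems]
      sum.remove[OF finite_down self_in_down[OF less.prems], of "\<lambda>z. newton z (-2)"] by simp
  have "partial_order P" by unfold_locales
  then have rec: "mobius P b y = (if b = y then 1
      else - (\<Sum>z | z \<in> carrier P \<and> le P b z \<and> le P z y \<and> z \<noteq> y. mobius P b z))"
    using less.prems bot finite_carrier by (subst mobius.simps) auto
  have set_eq: "{z. z \<in> carrier P \<and> le P b z \<and> le P z y \<and> z \<noteq> y} = down y - {y}"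
    using bot by (auto simp: down_def)
  show ?case
  proof (cases "y = b")
    case True
    then have "down y - {y} = {}" using bot le_antisym by (auto simp: down_def)
    then have "newton y (-2) = 1" using eq True by (simp only: sum.empty) simp
    then show ?thesis using rec True by simp
  next
    case False
    then show ?thesis using eq rec IH by (simp add: set_eq)
  qed
qed

section \<open>The zeta polynomial of a finite poset\<close>

text \<open>The argument is shifted by one against \<open>newton\<close>, since the zeta polynomial
  at \<open>m\<close> counts multichains of length \<open>m - 1\<close>.\<close>

definition newton_poly :: "'a \<Rightarrow> real poly" where
  "newton_poly y = (\<Sum>k\<le>card (carrier P).
     smult (real (card (chains_below y k)) / fact k) (\<Prod>i<k. [:- 1 - real i, 1:]))"

lemma poly_newton_poly: "poly (newton_poly y) m = newton y (m - 1)"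
proof -
  have "(\<Prod>i<k. m - 1 - real i) / fact k = ((m - 1) gchoose k)" for k
    by (simp add: gbinomial_prod_rev atLeast0LessThan)
  then show ?thesis
    by (simp add: newton_poly_def newton_def poly_sum poly_prod algebra_simps
        flip: times_divide_eq_right)
qed

text \<open>Two polynomials that agree at all integers from 2 on differ by one with infinitely many
  roots, so any polynomial with the right values resolves the \<open>THE\<close>.\<close>

lemma zeta_polynomial_unique:
  assumes "\<And>m. m \<ge> 2 \<Longrightarrow> poly p (real m) = real (card (multichains P (m - 1)))"
  shows "zeta_polynomial P = p"
  unfolding zeta_polynomial_def
proof (rule the_equality)
  fix q assume q: "\<forall>m\<ge>2. poly q (real m) = real (card (multichains P (m - 1)))"
  show "q = p"
  proof (rule ccontr)
    assume "q \<noteq> p"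
    then have "finite {x. poly (q - p) x = 0}"
      by (intro poly_roots_finite) auto
    moreover have "real ` {2..} \<subseteq> {x. poly (q - p) x = 0}"
      using q assms by auto
    ultimately have "finite (real ` {2..})" by (rule rev_finite_subset)
    then show False
      by (simp add: finite_image_iff infinite_Ici)
  qed
qed (use assms in auto)

context
  fixes t
  assumes top: "t \<in> carrier P" "\<And>y. y \<in> carrier P \<Longrightarrow> le P y t"
begin

lemma zeta_polynomial_eq_newton_poly: "zeta_polynomial P = newton_poly t"
proof (rule zeta_polynomial_unique)
  fix m :: nat assume "m \<ge> 2"
  moreover have "multichains_below t (m - 1) = multichains P (m - 1)"
    using top by (auto simp: multichains_below_def multichains_def down_def)
  ultimately show "poly (newton_poly t) (real m) = real (card (multichains P (m - 1)))"
    using card_multichains_below[OF top(1), of "m - 1"] by (simp add: poly_newton_poly of_nat_diff)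
qed

section \<open>Maximal chains of a bounded graded poset\<close>

context
  fixes rk :: "'a \<Rightarrow> nat"
  assumes rk_less: "\<And>x y. \<lbrakk>x \<in> carrier P; y \<in> carrier P; le P x y; x \<noteq> y\<rbrakk> \<Longrightarrow> rk x < rk y"
    and rk_gap: "\<And>x y. \<lbrakk>x \<in> carrier P; y \<in> carrier P; le P x y; rk x + 1 < rk y\<rbrakk>
      \<Longrightarrow> \<exists>z\<in>carrier P. le P x z \<and> le P z y \<and> z \<noteq> x \<and> z \<noteq> y"
    and rk_bot: "\<exists>b\<in>carrier P. rk b = 0 \<and> (\<forall>y\<in>carrier P. le P b y)"
begin

lemma inj_on_rk_chain:
  assumes "C \<subseteq> carrier P" "\<forall>a\<in>C. \<forall>b\<in>C. le P a b \<or> le P b a"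
  shows "inj_on rk C"
  by (rule inj_onI) (metis assms less_irrefl rk_less subsetD)

text \<open>Ranks along a chain are distinct and, \<open>t\<close> being excluded, smaller than
  \<open>rk t\<close>. Hence the coefficients of \<open>newton t\<close> beyond \<open>rk t\<close>
  vanish.\<close>

lemma chains_below_top_le_rk:
  assumes "C \<in> chains_below t k"
  shows "k \<le> rk t"
proof -
  have C: "C \<subseteq> carrier P" "t \<notin> C" "card C = k" "\<forall>a\<in>C. \<forall>b\<in>C. le P a b \<or> le P b a"
    using assms by (auto simp: chains_below_def down_def)
  have "rk ` C \<subseteq> {..<rk t}"
    using C top rk_less by blast
  then have "card (rk ` C) \<le> rk t"
    using card_mono[of "{..<rk t}"] by fastforce
  then show ?thesis
    using C card_image[OF inj_on_rk_chain] by simp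
qed

lemma chain_iff:
  "pred_on.chain (carrier P) (le P) C \<longleftrightarrow>
     C \<subseteq> carrier P \<and> (\<forall>a\<in>C. \<forall>b\<in>C. le P a b \<or> le P b a)"
  unfolding pred_on.chain_def using refl by blast

text \<open>A rank missing from the chain would split it into a lower part \<open>D\<close> and an
  upper part \<open>E\<close>. An element strictly between the top of \<open>D\<close> and the
  bottom of \<open>E\<close> is comparable with the whole chain, so it belongs to the chain by
  maximality, yet its rank fits into neither part.\<close>

lemma maximal_chain_rk:
  assumes "pred_on.maxchain (carrier P) (le P) C"
  shows "t \<in> C" "rk ` C = {..rk t}"
proof -
  have chain: "C \<subseteq> carrier P" "\<forall>a\<in>C. \<forall>b\<in>C. le P a b \<or> le P b a"
    using assms unfolding pred_on.maxchain_def chain_iff by auto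
  have maximal: "x \<in> C" if "x \<in> carrier P" "\<forall>a\<in>C. le P a x \<or> le P x a" for x
  proof (rule ccontr)
    assume "x \<notin> C"
    moreover have "pred_on.chain (carrier P) (le P) (insert x C)"
      using chain that refl[of x] unfolding chain_iff by blast
    ultimately show False
      using assms unfolding pred_on.maxchain_def by blast
  qed
  show "t \<in> C"
  proof (rule maximal)
    show "\<forall>a\<in>C. le P a t \<or> le P t a" using top(2) chain(1) by auto
  qed (rule top(1))
  obtain b where b: "b \<in> carrier P" "rk b = 0" "\<forall>y\<in>carrier P. le P b y"
    using rk_bot by blast
  have "b \<in> C"
  proof (rule maximal)
    show "\<forall>a\<in>C. le P a b \<or> le P b a" using b(3) chain(1) by auto
  qed (rule b(1))
  have fin: "finite C" using chain finite_carrier finite_subset by blast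
  have "k \<in> rk ` C" if k: "k \<le> rk t" for k
  proof (rule ccontr)
    assume no: "k \<notin> rk ` C"
    define D where "D = {x \<in> C. rk x < k}"
    define E where "E = {x \<in> C. rk x > k}"
    have DE: "C = D \<union> E" using no by (auto simp: D_def E_def)
    have "b \<in> D" using b \<open>b \<in> C\<close> no by (auto simp: D_def intro: neq0_conv[THEN iffD1])
    have "t \<in> E" using \<open>t \<in> C\<close> no k by (auto simp: E_def le_less)
    have finDE: "finite D" "finite E" using fin DE by auto
    obtain x where x: "x \<in> D" "\<And>y. y \<in> D \<Longrightarrow> rk y \<le> rk x"
      using finDE \<open>b \<in> D\<close> Max_in[of "rk ` D"] Max_ge[of "rk ` D"] by fastforce
    obtain y where y: "y \<in> E" "\<And>x. x \<in> E \<Longrightarrow> rk y \<le> rk x"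
      using finDE \<open>t \<in> E\<close> Min_in[of "rk ` E"] Min_le[of "rk ` E"] by fastforce
    have le_rk: "le P a c" if "a \<in> C" "c \<in> C" "rk a \<le> rk c" for a c
      using that chain rk_less[of c a] by (cases "a = c") force+
    \<comment> \<open>The missing rank \<open>k\<close> lies strictly between \<open>rk x\<close>
      and \<open>rk y\<close>, so these differ by at least two.\<close>
    have "le P x y" "rk x + 1 < rk y" "x \<in> carrier P" "y \<in> carrier P"
      using x y le_rk[of x y] chain by (auto simp: D_def E_def)
    then obtain z where z: "z \<in> carrier P" "le P x z" "le P z y" "z \<noteq> x" "z \<noteq> y"
      using rk_gap by blast
    have "le P a x" if "a \<in> D" for a
      using that x le_rk by (auto simp: D_def)
    moreover have "le P y a" if "a \<in> E" for a
      using that y le_rk by (auto simp: E_def)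
    ultimately have "le P a z \<or> le P z a" if "a \<in> C" for a
      using that z le_trans[of a x z] le_trans[of z y a] \<open>x \<in> carrier P\<close> \<open>y \<in> carrier P\<close> chain(1)
      unfolding DE by auto
    then have "z \<in> C" using maximal[OF z(1)] by simp
    moreover have "rk x < rk z" "rk z < rk y"
      using rk_less z \<open>x \<in> carrier P\<close> \<open>y \<in> carrier P\<close> by auto
    ultimately show False
      using x(2)[of z] y(2)[of z] DE by auto
  qed
  moreover have "rk x \<le> rk t" if "x \<in> C" for x
    using that chain top rk_less[of x t] by (cases "x = t") auto
  ultimately show "rk ` C = {..rk t}" by auto
qed

text \<open>A maximal chain contains \<open>t\<close> and meets every rank once. Conversely, a chain
  with that many members cannot be enlarged, by the bound on chains below \<open>t\<close>.\<close>

lemma maximal_chains_eq: "maximal_chains P = insert t ` chains_below t (rk t)"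
proof (intro equalityI subsetI)
  fix C assume "C \<in> maximal_chains P"
  then have C: "pred_on.maxchain (carrier P) (le P) C"
    by (simp add: maximal_chains_def)
  then have chain: "C \<subseteq> carrier P" "\<forall>a\<in>C. \<forall>b\<in>C. le P a b \<or> le P b a"
    unfolding pred_on.maxchain_def chain_iff by auto
  note rk = maximal_chain_rk[OF C]
  have "card C = Suc (rk t)"
    using card_image[OF inj_on_rk_chain[OF chain]] rk by simp
  moreover have "finite C" using chain finite_carrier finite_subset by blast
  ultimately have "C - {t} \<in> chains_below t (rk t)"
    using chain rk(1) top unfolding chains_below_def down_def by (auto simp: subset_iff)
  then show "C \<in> insert t ` chains_below t (rk t)"
    using rk(1) by (intro image_eqI[of _ _ "C - {t}"]) auto
next
  fix C assume "C \<in> insert t ` chains_below t (rk t)"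
  then obtain D where C: "C = insert t D" and D: "D \<in> chains_below t (rk t)" by auto
  have D': "D \<subseteq> carrier P" "t \<notin> D" "card D = rk t" "\<forall>a\<in>D. \<forall>b\<in>D. le P a b \<or> le P b a"
    using D by (auto simp: chains_below_def down_def)
  have "pred_on.chain (carrier P) (le P) C"
    using C D' top refl unfolding chain_iff by auto
  moreover have False if S: "pred_on.chain (carrier P) (le P) S" "C \<subset> S" for S
  proof -
    have S': "S \<subseteq> carrier P" "\<forall>a\<in>S. \<forall>b\<in>S. le P a b \<or> le P b a"
      using S unfolding chain_iff by auto
    have "S - {t} \<in> chains_below t (card (S - {t}))"
      using S' top by (auto simp: chains_below_def down_def)
    then have "card (S - {t}) \<le> rk t" by (rule chains_below_top_le_rk)
    moreover have "D \<subset> S - {t}" using S C D' by blast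
    ultimately show False
      using psubset_card_mono[of "S - {t}" D] S' finite_carrier finite_subset D' by fastforce
  qed
  ultimately show "C \<in> maximal_chains P"
    unfolding maximal_chains_def pred_on.maxchain_def by blast
qed

text \<open>In \<open>newton_poly t\<close> the basis polynomials of degree below
  \<open>rk t\<close> do not reach this coefficient, and those of higher degree occur with factor
  zero. The one of degree \<open>rk t\<close> is monic and carries the number of longest chains
  divided by \<open>fact (rk t)\<close>.\<close>

lemma card_maximal_chains:
  "real (card (maximal_chains P)) = fact (rk t) * coeff (zeta_polynomial P) (rk t)"
proof -
  let ?n = "rk t"
  let ?q = "\<lambda>k. \<Prod>i<k. [:- 1 - real i, 1:]"
  have deg: "degree (?q k) = k" for k
    by (subst degree_prod_eq_sum_degree) auto
  have lead: "coeff (?q k) k = 1" for k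
    using lead_coeff_prod[of "\<lambda>i. [:- 1 - real i, 1:]" "{..<k}"] by (simp add: deg)
  have "real (card (chains_below t k)) / fact k * coeff (?q k) ?n
      = (if k = ?n then real (card (chains_below t ?n)) / fact ?n else 0)" for k
  proof (cases k ?n rule: linorder_cases)
    case less
    then show ?thesis using coeff_eq_0[of "?q k" ?n] by (simp add: deg)
  next
    case greater
    then have "chains_below t k = {}" using chains_below_top_le_rk by fastforce
    then show ?thesis using greater by simp
  qed (simp add: lead)
  then have "coeff (zeta_polynomial P) ?n = (\<Sum>k\<le>card (carrier P).
      if k = ?n then real (card (chains_below t ?n)) / fact ?n else 0)"
    by (simp add: zeta_polynomial_eq_newton_poly newton_poly_def coeff_sum)
  also have "\<dots> = real (card (chains_below t ?n)) / fact ?n"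
    by (auto simp: not_le chains_below_eq_empty)
  also have "card (chains_below t ?n) = card (maximal_chains P)"
    unfolding maximal_chains_eq
    by (intro card_image[symmetric] inj_onI) (auto simp: chains_below_def insert_ident)
  finally show ?thesis by simp
qed

end

end

end

section \<open>Labelled matchings\<close>

text \<open>A labelled matching of \<open>A\<close> sends an unmatched point to its label and a matched point to its
  partner together with the label of the pair, which is therefore stored twice.\<close>

definition matchings :: "'i set \<Rightarrow> 'a set \<Rightarrow> 'b set \<Rightarrow> ('i \<Rightarrow> 'a + 'i \<times> 'b) set" where
  "matchings A S T = {c. \<forall>i. if i \<in> A
     then (case c i of Inl s \<Rightarrow> s \<in> S
           | Inr (j, t) \<Rightarrow> j \<in> A \<and> j \<noteq> i \<and> t \<in> T \<and> c j = Inr (i, t))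
     else c i = undefined}"

definition label_weight :: "('a \<Rightarrow> 'r) \<Rightarrow> ('b \<Rightarrow> 'r) \<Rightarrow> 'a + 'i \<times> 'b \<Rightarrow> 'r" where
  "label_weight f g x = (case x of Inl s \<Rightarrow> f s | Inr (j, t) \<Rightarrow> g t)"

text \<open>The product runs over points, so a pair contributes the square of
  \<open>g t\<close>.\<close>

definition weight :: "('a \<Rightarrow> 'r) \<Rightarrow> ('b \<Rightarrow> 'r) \<Rightarrow> 'i set \<Rightarrow> ('i \<Rightarrow> 'a + 'i \<times> 'b) \<Rightarrow> 'r::comm_semiring_1"
  where "weight f g A c = (\<Prod>i\<in>A. label_weight f g (c i))"

lemma matchings_empty: "matchings {} S T = {\<lambda>_. undefined}"
  by (auto simp: matchings_def)

text \<open>The sum over partial matchings of an \<open>n\<close>-set with weight \<open>a\<close> for each unmatched point and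
  \<open>b\<close> for each pair (a rescaled Hermite polynomial).\<close>

definition hermite_sum :: "nat \<Rightarrow> 'r \<Rightarrow> 'r \<Rightarrow> 'r::comm_semiring_1" where
  "hermite_sum n a b =
     (\<Sum>k=0..n div 2. of_nat ((n choose (2 * k)) * odd_double_fact k) * a ^ (n - 2 * k) * b ^ k)"

section \<open>Hermite recursion\<close>

lemma odd_double_fact_Suc: "odd_double_fact (Suc k) = (2 * k + 1) * odd_double_fact k"
  by (simp add: odd_double_fact_def)

lemma odd_double_fact_0: "odd_double_fact 0 = 1"
  by (simp add: odd_double_fact_def)

lemma hermite_sum_0: "hermite_sum 0 a b = 1"
  by (simp add: hermite_sum_def odd_double_fact_0)

lemma hermite_sum_1: "hermite_sum (Suc 0) a b = a"
  by (simp add: hermite_sum_def odd_double_fact_0)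

text \<open>Summands with \<open>2 * k > n\<close> vanish through the binomial coefficient. A freely
  chosen upper limit lets the sums for consecutive \<open>n\<close> be compared term by
  term.\<close>

lemma hermite_sum_upto:
  assumes "n div 2 \<le> N"
  shows "hermite_sum n a b =
    (\<Sum>k\<le>N. of_nat ((n choose (2 * k)) * odd_double_fact k) * a ^ (n - 2 * k) * b ^ k)"
  unfolding hermite_sum_def
proof (rule sum.mono_neutral_left)
  show "\<forall>k\<in>{..N} - {0..n div 2}.
      of_nat ((n choose (2 * k)) * odd_double_fact k) * a ^ (n - 2 * k) * b ^ k = 0"
  proof
    fix k assume "k \<in> {..N} - {0..n div 2}"
    then have "n < 2 * k" by auto
    then show "of_nat ((n choose (2 * k)) * odd_double_fact k) * a ^ (n - 2 * k) * b ^ k = 0"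
      by (simp add: binomial_eq_0)
  qed
qed (use assms in auto)

text \<open>Pascal's rule, followed by absorption of the factor \<open>2 * k + 1\<close>.
  Combinatorially, a distinguished point is unmatched or has one of the \<open>Suc n\<close> other
  points as its partner.\<close>

lemma hermite_coeff_Suc_Suc:
  "(Suc (Suc n) choose (2 * Suc k)) * odd_double_fact (Suc k)
    = (Suc n choose (2 * Suc k)) * odd_double_fact (Suc k)
      + Suc n * ((n choose (2 * k)) * odd_double_fact k)"
proof -
  have "(Suc n choose Suc (2 * k)) * Suc (2 * k) = Suc n * (n choose (2 * k))"
    by (metis Suc_times_binomial mult.commute)
  then have "(Suc n choose Suc (2 * k)) * odd_double_fact (Suc k)
      = Suc n * ((n choose (2 * k)) * odd_double_fact k)"
    by (simp only: odd_double_fact_Suc Suc_eq_plus1[symmetric] mult.assoc[symmetric])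
  moreover have "Suc (Suc n) choose (2 * Suc k) = (Suc n choose (2 * Suc k)) + (Suc n choose Suc (2 * k))"
    by simp
  ultimately show ?thesis by (simp only: add_mult_distrib)
qed

lemma hermite_sum_Suc_Suc:
  "hermite_sum (Suc (Suc n)) a b = a * hermite_sum (Suc n) a b + of_nat (Suc n) * b * hermite_sum n a b"
proof -
  let ?c = "\<lambda>n k. (n choose (2 * k)) * odd_double_fact k"
  let ?f = "\<lambda>n k. of_nat (?c n k) * a ^ (n - 2 * k) * b ^ k"
  \<comment> \<open>For \<open>2 * k > Suc n\<close> truncated subtraction spoils the comparison of
    exponents, but then the binomial coefficient is zero.\<close>
  have A: "a * ?f (Suc n) k = of_nat (?c (Suc n) k) * a ^ (Suc (Suc n) - 2 * k) * b ^ k" for k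
  proof (cases "2 * k \<le> Suc n")
    case True
    then have "Suc (Suc n) - 2 * k = Suc (Suc n - 2 * k)" by simp
    then show ?thesis by (simp only: power_Suc ac_simps)
  qed (simp add: binomial_eq_0)
  have B: "of_nat (Suc n) * b * ?f n k
      = of_nat (Suc n * ?c n k) * a ^ (Suc (Suc n) - 2 * Suc k) * b ^ Suc k" for k
  proof -
    have "Suc (Suc n) - 2 * Suc k = n - 2 * k" by simp
    then show ?thesis by (simp only: of_nat_mult power_Suc ac_simps)
  qed
  have "a * hermite_sum (Suc n) a b + of_nat (Suc n) * b * hermite_sum n a b
      = (\<Sum>k\<le>Suc n. a * ?f (Suc n) k) + (\<Sum>k\<le>n. of_nat (Suc n) * b * ?f n k)"
    by (simp only: hermite_sum_upto[of "Suc n" "Suc n"] hermite_sum_upto[of n n] sum_distrib_left)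
  also have "\<dots> = a * ?f (Suc n) 0 + (\<Sum>k\<le>n. a * ?f (Suc n) (Suc k) + of_nat (Suc n) * b * ?f n k)"
    by (simp only: sum.atMost_Suc_shift sum.distrib add.assoc)
  also have "\<dots> = ?f (Suc (Suc n)) 0 + (\<Sum>k\<le>n. ?f (Suc (Suc n)) (Suc k))"
  proof -
    have "a * ?f (Suc n) (Suc k) + of_nat (Suc n) * b * ?f n k = ?f (Suc (Suc n)) (Suc k)" for k
      unfolding A B hermite_coeff_Suc_Suc of_nat_add by (simp only: distrib_right)
    moreover have "a * ?f (Suc n) 0 = ?f (Suc (Suc n)) 0" by (simp add: ac_simps)
    ultimately show ?thesis by (simp only:)
  qed
  also have "\<dots> = hermite_sum (Suc (Suc n)) a b"
    by (simp only: hermite_sum_upto[of "Suc (Suc n)" "Suc n"] sum.atMost_Suc_shift)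
  finally show ?thesis ..
qed

section \<open>Summing weights over labelled matchings\<close>

lemma matchings_insert:
  assumes "x \<notin> A"
  shows "matchings (insert x A) S T =
      (\<lambda>(s, c). c(x := Inl s)) ` (S \<times> matchings A S T) \<union>
      (\<Union>y\<in>A. (\<lambda>(t, c). c(x := Inr (y, t), y := Inr (x, t))) ` (T \<times> matchings (A - {y}) S T))"
    (is "_ = ?U \<union> ?M")
proof (intro equalityI subsetI)
  fix c assume c: "c \<in> matchings (insert x A) S T"
  have cD: "case c i of Inl s \<Rightarrow> s \<in> S
      | Inr (j, t) \<Rightarrow> j \<in> insert x A \<and> j \<noteq> i \<and> t \<in> T \<and> c j = Inr (i, t)" if "i \<in> insert x A" for i
    using c that unfolding matchings_def by (auto split: if_splits)
  have cU: "c i = undefined" if "i \<notin> insert x A" for i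
    using c that unfolding matchings_def by auto
  show "c \<in> ?U \<union> ?M"
  proof (cases "c x")
    case (Inl s)
    have "c(x := undefined) \<in> matchings A S T"
      unfolding matchings_def
    proof (intro CollectI allI)
      fix i
      show "if i \<in> A then (case (c(x := undefined)) i of Inl s \<Rightarrow> s \<in> S
           | Inr (j, t) \<Rightarrow> j \<in> A \<and> j \<noteq> i \<and> t \<in> T \<and> (c(x := undefined)) j = Inr (i, t))
        else (c(x := undefined)) i = undefined"
        using cD[of i] cU[of i] assms Inl by (auto split: sum.splits)
    qed
    moreover have "s \<in> S" using cD[of x] Inl by simp
    ultimately have "c \<in> ?U"
      using Inl by (intro image_eqI[of _ _ "(s, c(x := undefined))"]) auto
    then show ?thesis ..
  next
    case (Inr p)
    obtain y t where p: "p = (y, t)" by fastforce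
    have y: "y \<in> A" "t \<in> T" "c y = Inr (x, t)" "y \<noteq> x"
      using cD[of x] Inr p by auto
    have "c(x := undefined, y := undefined) \<in> matchings (A - {y}) S T"
      unfolding matchings_def
    proof (intro CollectI allI)
      fix i
      show "if i \<in> A - {y} then (case (c(x := undefined, y := undefined)) i of Inl s \<Rightarrow> s \<in> S
           | Inr (j, t) \<Rightarrow> j \<in> A - {y} \<and> j \<noteq> i \<and> t \<in> T \<and>
               (c(x := undefined, y := undefined)) j = Inr (i, t))
        else (c(x := undefined, y := undefined)) i = undefined"
        using cD[of i] cU[of i] assms Inr p y by (auto split: sum.splits)
    qed
    then have "c \<in> (\<lambda>(t, c). c(x := Inr (y, t), y := Inr (x, t))) ` (T \<times> matchings (A - {y}) S T)"
      using Inr p y by (intro image_eqI[of _ _ "(t, c(x := undefined, y := undefined))"]) auto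
    then show ?thesis using y by blast
  qed
next
  fix c assume "c \<in> ?U \<union> ?M"
  then show "c \<in> matchings (insert x A) S T"
  proof
    assume "c \<in> ?U"
    then obtain s d where c: "c = d(x := Inl s)" "s \<in> S" and d: "d \<in> matchings A S T" by auto
    have dD: "case d i of Inl s \<Rightarrow> s \<in> S
        | Inr (j, t) \<Rightarrow> j \<in> A \<and> j \<noteq> i \<and> t \<in> T \<and> d j = Inr (i, t)" if "i \<in> A" for i
      using d that unfolding matchings_def by (auto split: if_splits)
    have dU: "d i = undefined" if "i \<notin> A" for i
      using d that unfolding matchings_def by auto
    show ?thesis
      unfolding matchings_def
    proof (intro CollectI allI)
      fix i
      show "if i \<in> insert x A then (case c i of Inl s \<Rightarrow> s \<in> S
           | Inr (j, t) \<Rightarrow> j \<in> insert x A \<and> j \<noteq> i \<and> t \<in> T \<and> c j = Inr (i, t))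
        else c i = undefined"
        using dD[of i] dU[of i] assms c by (auto split: sum.splits)
    qed
  next
    assume "c \<in> ?M"
    then obtain y t d where c: "c = d(x := Inr (y, t), y := Inr (x, t))" "t \<in> T" "y \<in> A"
      and d: "d \<in> matchings (A - {y}) S T" by auto
    have dD: "case d i of Inl s \<Rightarrow> s \<in> S
        | Inr (j, t) \<Rightarrow> j \<in> A - {y} \<and> j \<noteq> i \<and> t \<in> T \<and> d j = Inr (i, t)" if "i \<in> A - {y}" for i
      using d that unfolding matchings_def by (auto split: if_splits)
    have dU: "d i = undefined" if "i \<notin> A - {y}" for i
      using d that unfolding matchings_def by auto
    show ?thesis
      unfolding matchings_def
    proof (intro CollectI allI)
      fix i
      show "if i \<in> insert x A then (case c i of Inl s \<Rightarrow> s \<in> S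
           | Inr (j, t) \<Rightarrow> j \<in> insert x A \<and> j \<noteq> i \<and> t \<in> T \<and> c j = Inr (i, t))
        else c i = undefined"
        using dD[of i] dU[of i] assms c by (auto split: sum.splits)
    qed
  qed
qed

lemma matchings_outside: "\<lbrakk>c \<in> matchings A S T; i \<notin> A\<rbrakk> \<Longrightarrow> c i = undefined"
  by (auto simp: matchings_def)

lemma finite_matchings:
  assumes "finite A" "finite S" "finite T"
  shows "finite (matchings A S T)"
  using assms(1)
proof (induction A rule: finite_psubset_induct)
  case (psubset A)
  show ?case
  proof (cases "A = {}")
    case False
    then obtain x where "x \<in> A" by blast
    then have A: "A = insert x (A - {x})" by blast
    have "finite (matchings (A - {x}) S T)" "\<And>y. y \<in> A - {x} \<Longrightarrow> finite (matchings (A - {x} - {y}) S T)"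
      using psubset \<open>x \<in> A\<close> by (blast intro: psubset.IH)+
    then show ?thesis
      using assms psubset.hyps by (subst A, subst matchings_insert) auto
  qed (simp add: matchings_empty)
qed

text \<open>Removing one point \<open>x\<close> reproduces the recursion of
  \<open>hermite_sum\<close>: an unmatched \<open>x\<close> contributes the sum of \<open>f\<close>,
  and each possible partner contributes the sum of the squares of \<open>g\<close>.\<close>

lemma sum_weight_matchings:
  fixes f :: "'a \<Rightarrow> 'r::comm_semiring_1"
  assumes "finite A" "finite S" "finite T"
  shows "(\<Sum>c\<in>matchings A S T. weight f g A c) = hermite_sum (card A) (sum f S) (\<Sum>t\<in>T. g t ^ 2)"
  using assms(1)
proof (induction A rule: finite_psubset_induct)
  case (psubset A)
  let ?a = "sum f S" and ?b = "\<Sum>t\<in>T. g t ^ 2"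
  show ?case
  proof (cases "A = {}")
    case True
    then show ?thesis by (simp add: matchings_empty weight_def hermite_sum_0)
  next
    case False
    then obtain x where "x \<in> A" by blast
    define B where "B = A - {x}"
    have A: "A = insert x B" and xB: "x \<notin> B" and finB: "finite B"
      using \<open>x \<in> A\<close> psubset.hyps by (auto simp: B_def)
    let ?u = "\<lambda>(s, c). c(x := Inl s)"
    let ?m = "\<lambda>y (t, c). c(x := Inr (y, t), y := Inr (x, t))"
    let ?U = "?u ` (S \<times> matchings B S T)"
    let ?M = "\<lambda>y. ?m y ` (T \<times> matchings (B - {y}) S T)"
    note fin = finite_matchings[OF _ assms(2,3)]
    have undef: "c x = undefined" if "c \<in> matchings D S T" "x \<notin> D" for c D
      using that by (rule matchings_outside)
    have inj_u: "inj_on ?u (S \<times> matchings B S T)"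
    proof (rule inj_onI, clarify)
      fix s c s' c' assume c: "c \<in> matchings B S T" "c' \<in> matchings B S T"
        and eq: "c(x := Inl s) = c'(x := Inl s' :: 'a + 'b \<times> 'c)"
      have "s = s'" using fun_cong[OF eq, of x] by simp
      moreover have "c i = c' i" for i
        using fun_cong[OF eq, of i] undef[OF c(1) xB] undef[OF c(2) xB] by (cases "i = x") auto
      ultimately show "s = s' \<and> c = c'" by auto
    qed
    have inj_m: "inj_on (?m y) (T \<times> matchings (B - {y}) S T)" if y: "y \<in> B" for y
    proof (rule inj_onI, clarify)
      fix t c t' c' assume c: "c \<in> matchings (B - {y}) S T" "c' \<in> matchings (B - {y}) S T"
        and eq: "c(x := Inr (y, t), y := Inr (x, t)) = c'(x := Inr (y, t'), y := Inr (x, t') :: 'a + 'b \<times> 'c)"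
      have "t = t'" using fun_cong[OF eq, of y] by simp
      moreover have "c i = c' i" for i
        using fun_cong[OF eq, of i] matchings_outside[OF c(1)] matchings_outside[OF c(2)] xB
        by (cases "i = x"; cases "i = y") auto
      ultimately show "t = t' \<and> c = c'" by auto
    qed
    have wu: "weight f g A (?u (s, c)) = f s * weight f g B c" for s c
    proof -
      have "(\<Prod>i\<in>B. label_weight f g ((c(x := Inl s)) i)) = (\<Prod>i\<in>B. label_weight f g (c i))"
        using xB by (intro prod.cong) auto
      then show ?thesis
        using finB xB by (simp add: A weight_def label_weight_def)
    qed
    have wm: "weight f g A (?m y (t, c)) = g t ^ 2 * weight f g (B - {y}) c" if y: "y \<in> B" for y t c
    proof -
      let ?c = "c(x := Inr (y, t), y := Inr (x, t))"
      have "y \<noteq> x" using y xB by auto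
      have "weight f g A ?c = label_weight f g (?c x) * (\<Prod>i\<in>B. label_weight f g (?c i))"
        unfolding weight_def A by (rule prod.insert[OF finB xB])
      also have "(\<Prod>i\<in>B. label_weight f g (?c i))
          = label_weight f g (?c y) * (\<Prod>i\<in>B - {y}. label_weight f g (?c i))"
        by (rule prod.remove[OF finB y])
      also have "label_weight f g (?c y) = g t"
        by (simp add: label_weight_def)
      also have "label_weight f g (?c x) = g t"
        using \<open>y \<noteq> x\<close> by (simp add: label_weight_def)
      also have "(\<Prod>i\<in>B - {y}. label_weight f g (?c i)) = weight f g (B - {y}) c"
        unfolding weight_def using xB by (intro prod.cong) auto
      finally show ?thesis by (simp only: power2_eq_square mult.assoc prod.case)
    qed
    have disj1: "?U \<inter> (\<Union>y\<in>B. ?M y) = {}"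
    proof (rule ccontr)
      assume "\<not> ?thesis"
      then obtain y s c t c' where "y \<in> B"
        and eq: "c(x := Inl s) = c'(x := Inr (y, t), y := Inr (x, t) :: 'a + 'b \<times> 'c)"
        by auto
      show False using fun_cong[OF eq, of x] \<open>y \<in> B\<close> xB by (auto split: if_splits)
    qed
    have disj2: "?M y \<inter> ?M z = {}" if "y \<in> B" "z \<in> B" "y \<noteq> z" for y z
    proof (rule ccontr)
      assume "\<not> ?thesis"
      then obtain c t c' t' where
        eq: "c(x := Inr (y, t), y := Inr (x, t)) = c'(x := Inr (z, t'), z := Inr (x, t') :: 'a + 'b \<times> 'c)"
        by auto
      show False using fun_cong[OF eq, of x] xB that by (auto split: if_splits)
    qed
    have "(\<Sum>c\<in>matchings A S T. weight f g A c)
        = (\<Sum>c\<in>?U. weight f g A c) + (\<Sum>c\<in>(\<Union>y\<in>B. ?M y). weight f g A c)"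
      unfolding A matchings_insert[OF xB] using disj1 assms finB
      by (intro sum.union_disjoint) (auto intro!: fin)
    also have "(\<Sum>c\<in>?U. weight f g A c) = ?a * hermite_sum (card B) ?a ?b"
    proof -
      have "(\<Sum>c\<in>?U. weight f g A c) = (\<Sum>p\<in>S \<times> matchings B S T. weight f g A (?u p))"
        by (simp add: sum.reindex[OF inj_u])
      also have "\<dots> = (\<Sum>(s, c)\<in>S \<times> matchings B S T. f s * weight f g B c)"
        using wu by (intro sum.cong) auto
      also have "\<dots> = ?a * (\<Sum>c\<in>matchings B S T. weight f g B c)"
        by (simp add: sum.cartesian_product[symmetric] sum_product)
      also have "(\<Sum>c\<in>matchings B S T. weight f g B c) = hermite_sum (card B) ?a ?b"
        using A xB by (intro psubset.IH) auto
      finally show ?thesis .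
    qed
    also have "(\<Sum>c\<in>(\<Union>y\<in>B. ?M y). weight f g A c) = (\<Sum>y\<in>B. \<Sum>c\<in>?M y. weight f g A c)"
      using disj2 assms finB by (intro sum.UNION_disjoint) (auto intro!: fin)
    also have "\<dots> = (\<Sum>y\<in>B. ?b * hermite_sum (card B - 1) ?a ?b)"
    proof (rule sum.cong)
      fix y assume y: "y \<in> B"
      have "(\<Sum>c\<in>?M y. weight f g A c) = (\<Sum>p\<in>T \<times> matchings (B - {y}) S T. weight f g A (?m y p))"
        by (simp add: sum.reindex[OF inj_m[OF y]])
      also have "\<dots> = (\<Sum>(t, c)\<in>T \<times> matchings (B - {y}) S T. g t ^ 2 * weight f g (B - {y}) c)"
        using wm[OF y] by (intro sum.cong) auto
      also have "\<dots> = ?b * (\<Sum>c\<in>matchings (B - {y}) S T. weight f g (B - {y}) c)"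
        by (simp add: sum.cartesian_product[symmetric] sum_product)
      also have "(\<Sum>c\<in>matchings (B - {y}) S T. weight f g (B - {y}) c)
          = hermite_sum (card (B - {y})) ?a ?b"
        using A xB by (intro psubset.IH) auto
      also have "card (B - {y}) = card B - 1" using y by simp
      finally show "(\<Sum>c\<in>?M y. weight f g A c) = ?b * hermite_sum (card B - 1) ?a ?b" .
    qed simp
    also have "\<dots> = of_nat (card B) * ?b * hermite_sum (card B - 1) ?a ?b"
      by (simp add: mult.assoc)
    also have "?a * hermite_sum (card B) ?a ?b + \<dots> = hermite_sum (card A) ?a ?b"
    \<comment> \<open>For empty \<open>B\<close> the truncated \<open>card B - 1\<close> is
      harmless, because its factor \<open>of_nat (card B)\<close> is zero.\<close>
    proof (cases "card B")
      case 0
      then show ?thesis using finB xB by (simp add: A hermite_sum_0 hermite_sum_1)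
    next
      case (Suc n)
      then show ?thesis using finB xB by (simp add: A hermite_sum_Suc_Suc)
    qed
    finally show ?thesis .
  qed
qed

lemma card_matchings:
  assumes "finite A" "finite S" "finite T"
  shows "card (matchings A S T) = hermite_sum (card A) (card S) (card T)"
proof -
  have "label_weight (\<lambda>_. 1 :: nat) (\<lambda>_. 1) x = 1" for x :: "'b + 'a \<times> 'c"
    by (simp add: label_weight_def split: sum.splits)
  then show ?thesis
    using sum_weight_matchings[OF assms, of "\<lambda>_. 1" "\<lambda>_. 1 :: nat"] by (simp add: weight_def)
qed

section \<open>Words in the reflections\<close>

lemma hyperoctahedral_iff:
  "w \<in> hyperoctahedral n \<longleftrightarrow>
     bij w \<and> (\<forall>i. w (- i) = - w i) \<and> (\<forall>i. i \<notin> signed_set n \<longrightarrow> w i = i)"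
proof
  assume w: "w \<in> hyperoctahedral n"
  then have p: "w permutes signed_set n" and odd: "\<And>i. i \<in> signed_set n \<Longrightarrow> w (- i) = - w i"
    by (auto simp: hyperoctahedral_def)
  have "w (- i) = - w i" for i
  proof (cases "i \<in> signed_set n")
    case False
    then have "- i \<notin> signed_set n" by (auto simp: signed_set_def)
    then show ?thesis using False permutes_not_in[OF p] by simp
  qed (rule odd)
  then show "bij w \<and> (\<forall>i. w (- i) = - w i) \<and> (\<forall>i. i \<notin> signed_set n \<longrightarrow> w i = i)"
    using permutes_bij[OF p] permutes_not_in[OF p] by blast
next
  assume w: "bij w \<and> (\<forall>i. w (- i) = - w i) \<and> (\<forall>i. i \<notin> signed_set n \<longrightarrow> w i = i)"
  then have "w permutes signed_set n"
    unfolding permutes_def using bij_iff by metis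
  then show "w \<in> hyperoctahedral n"
    using w by (simp add: hyperoctahedral_def)
qed

lemma hyperoctahedral_bij: "w \<in> hyperoctahedral n \<Longrightarrow> bij w"
  and hyperoctahedral_odd: "w \<in> hyperoctahedral n \<Longrightarrow> w (- i) = - w i"
  and hyperoctahedral_outside: "\<lbrakk>w \<in> hyperoctahedral n; i \<notin> signed_set n\<rbrakk> \<Longrightarrow> w i = i"
  by (auto simp: hyperoctahedral_iff)

lemma hyperoctahedral_id: "id \<in> hyperoctahedral n"
  by (simp add: hyperoctahedral_iff)

lemma hyperoctahedral_comp:
  "\<lbrakk>u \<in> hyperoctahedral n; v \<in> hyperoctahedral n\<rbrakk> \<Longrightarrow> u \<circ> v \<in> hyperoctahedral n"
  unfolding hyperoctahedral_iff using bij_comp by fastforce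

lemma hyperoctahedral_inv:
  assumes "u \<in> hyperoctahedral n"
  shows "inv u \<in> hyperoctahedral n"
proof -
  have u: "bij u" "\<And>i. u (- i) = - u i" "\<And>i. i \<notin> signed_set n \<Longrightarrow> u i = i"
    using assms by (auto simp: hyperoctahedral_iff)
  have "inv u (- i) = - inv u i" for i
    using u by (intro inv_f_eq) (auto simp: bij_is_inj bij_is_surj surj_f_inv_f)
  moreover have "inv u i = i" if "i \<notin> signed_set n" for i
    using u that by (intro inv_f_eq) (auto simp: bij_is_inj)
  ultimately show ?thesis
    using u bij_imp_bij_inv by (auto simp: hyperoctahedral_iff)
qed

lemma comp_inv_comp: "u \<in> hyperoctahedral n \<Longrightarrow> u \<circ> (inv u \<circ> v) = v"
  using hyperoctahedral_bij[of u n] by (auto simp: fun_eq_iff bij_is_surj surj_f_inv_f)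

lemma inv_comp_comp: "u \<in> hyperoctahedral n \<Longrightarrow> inv u \<circ> (u \<circ> v) = v"
  using hyperoctahedral_bij[of u n] by (auto simp: fun_eq_iff bij_is_inj)

section \<open>Sign changes and paired cycles as reflections\<close>

lemma sign_change_apply: "sign_change i k = (if k = i \<or> k = - i then - k else k)"
  by (auto simp: sign_change_def transpose_def)

lemma paired_cycle_apply:
  assumes "a \<noteq> 0" "b \<noteq> 0" "a \<noteq> b" "a \<noteq> - b"
  shows "paired_cycle a b k =
    (if k = a then b else if k = b then a else if k = - a then - b else if k = - b then - a else k)"
  using assms by (auto simp: paired_cycle_def transpose_def)

lemma sign_change_in_reflections: "i \<in> signed_set n \<Longrightarrow> sign_change i \<in> reflections n"
proof -
  assume i: "i \<in> signed_set n"
  have "sign_change i = sign_change \<bar>i\<bar>"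
    by (auto simp: fun_eq_iff sign_change_apply abs_if)
  moreover have "1 \<le> \<bar>i\<bar> \<and> \<bar>i\<bar> \<le> int n" using i by (auto simp: signed_set_def)
  ultimately show ?thesis unfolding reflections_def by blast
qed

text \<open>\<open>reflections\<close> lists only pairs whose first entry is positive and of smaller
  absolute value. A paired cycle is unchanged when its entries are swapped or both negated, which
  reaches these representatives.\<close>

lemma paired_cycle_in_reflections:
  assumes "a \<in> signed_set n" "b \<in> signed_set n" "a \<noteq> b" "a \<noteq> - b"
  shows "paired_cycle a b \<in> reflections n"
proof -
  have pos: "paired_cycle i b \<in> reflections n"
    if "1 \<le> i" "i < \<bar>b\<bar>" "\<bar>b\<bar> \<le> int n" for i b
  proof (cases "b > 0")
    case True
    then show ?thesis using that unfolding reflections_def by auto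
  next
    case False
    then have "paired_cycle i b = paired_cycle i (- \<bar>b\<bar>)" by simp
    then show ?thesis using that unfolding reflections_def by blast
  qed
  have lt: "paired_cycle a b \<in> reflections n"
    if "a \<in> signed_set n" "b \<in> signed_set n" "\<bar>a\<bar> < \<bar>b\<bar>" for a b
  proof (cases "a > 0")
    case True
    then show ?thesis using that by (intro pos) (auto simp: signed_set_def)
  next
    case False
    have nz: "a \<noteq> 0" "b \<noteq> 0" "a \<noteq> b" "a \<noteq> - b" using that by (auto simp: signed_set_def)
    have "paired_cycle a b = paired_cycle (- a) (- b)"
      using nz by (auto simp: fun_eq_iff paired_cycle_apply)
    then show ?thesis using that False pos[of "- a" "- b"] by (auto simp: signed_set_def)
  qed
  have nz: "a \<noteq> 0" "b \<noteq> 0" using assms by (auto simp: signed_set_def)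
  have "paired_cycle a b = paired_cycle b a"
    using nz assms by (auto simp: fun_eq_iff paired_cycle_apply)
  moreover have "\<bar>a\<bar> \<noteq> \<bar>b\<bar>" using assms by (auto simp: abs_if split: if_splits)
  ultimately show ?thesis
    using lt[of a b] lt[of b a] assms by (cases "\<bar>a\<bar> < \<bar>b\<bar>") auto
qed

lemma reflections_cases:
  assumes "t \<in> reflections n"
  obtains (sign) i where "i \<in> signed_set n" "t = sign_change i"
    | (pair) a b where "a \<in> signed_set n" "b \<in> signed_set n" "a \<noteq> b" "a \<noteq> - b" "t = paired_cycle a b"
proof -
  consider i where "1 \<le> i" "i \<le> int n" "t = sign_change i"
    | i j where "1 \<le> i" "i < j" "j \<le> int n" "t = paired_cycle i j"
    | i j where "1 \<le> i" "i < j" "j \<le> int n" "t = paired_cycle i (- j)"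
    using assms unfolding reflections_def by blast
  then show ?thesis
  proof cases
    case 1
    then show ?thesis by (intro sign) (auto simp: signed_set_def)
  next
    case 2
    then show ?thesis by (intro pair[of i j]) (auto simp: signed_set_def)
  next
    case 3
    then show ?thesis by (intro pair[of i "- j"]) (auto simp: signed_set_def)
  qed
qed

lemma reflection_involution:
  assumes "t \<in> reflections n"
  shows "t (t k) = k"
  using assms
proof (cases rule: reflections_cases)
  case (pair a b)
  then have "a \<noteq> 0" "b \<noteq> 0" by (auto simp: signed_set_def)
  then show ?thesis using pair by (auto simp: paired_cycle_apply)
qed (auto simp: sign_change_apply)

lemma reflections_subset: "reflections n \<subseteq> hyperoctahedral n"
proof
  fix t assume t: "t \<in> reflections n"
  have "bij t" by (rule o_bij[of t]) (auto simp: reflection_involution[OF t])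
  moreover have "t (- k) = - t k \<and> (k \<notin> signed_set n \<longrightarrow> t k = k)" for k
    using t
  proof (cases rule: reflections_cases)
    case (pair a b)
    then have "a \<noteq> 0" "b \<noteq> 0" by (auto simp: signed_set_def)
    then show ?thesis using pair by (auto simp: paired_cycle_apply signed_set_def)
  qed (auto simp: sign_change_apply signed_set_def)
  ultimately show "t \<in> hyperoctahedral n"
    by (simp add: hyperoctahedral_iff)
qed

section \<open>Words and absolute length\<close>

lemma composition_Nil [simp]: "composition [] = id"
  and composition_Cons [simp]: "composition (t # ts) = t \<circ> composition ts"
  by (simp_all add: composition_def)

lemma composition_append: "composition (xs @ ys) = composition xs \<circ> composition ys"
  by (induction xs) (auto simp: comp_assoc)

lemma composition_in_hyperoctahedral:
  "set ts \<subseteq> reflections n \<Longrightarrow> composition ts \<in> hyperoctahedral n"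
  using reflections_subset by (induction ts) (auto intro!: hyperoctahedral_id hyperoctahedral_comp)

lemma abs_length_le: "set ts \<subseteq> reflections n \<Longrightarrow> abs_length n (composition ts) \<le> length ts"
  unfolding abs_length_def by (rule Least_le) blast

lemma finite_signed_set: "finite (signed_set n)"
  by (simp add: signed_set_def)

text \<open>A reflection that sends \<open>w i\<close> back to \<open>i\<close>, multiplied from the
  left, makes \<open>i\<close> a fixed point and disturbs no existing one, so the number of moved
  points drops.\<close>

lemma ex_word:
  assumes "w \<in> hyperoctahedral n"
  shows "\<exists>ts. set ts \<subseteq> reflections n \<and> composition ts = w"
  using assms
proof (induction "card {k \<in> signed_set n. w k \<noteq> k}" arbitrary: w rule: less_induct)
  case less
  show ?case
  proof (cases "\<exists>i\<in>signed_set n. w i \<noteq> i")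
    case False
    then have "w = id"
      using hyperoctahedral_outside[OF less.prems] by (auto simp: fun_eq_iff)
    then show ?thesis by (intro exI[of _ "[]"]) auto
  next
    case True
    then obtain i where i: "i \<in> signed_set n" "w i \<noteq> i" by blast
    define j where "j = w i"
    have inj: "w k = w l \<longleftrightarrow> k = l" for k l
      using hyperoctahedral_bij[OF less.prems] by (simp add: bij_is_inj inj_eq)
    have odd: "w (- k) = - w k" for k by (rule hyperoctahedral_odd[OF less.prems])
    have j: "j \<in> signed_set n"
      using inj[of "w i" i] hyperoctahedral_outside[OF less.prems, of "w i"] i by (auto simp: j_def)
    have nz: "i \<noteq> 0" "j \<noteq> 0" using i j by (auto simp: signed_set_def)
    \<comment> \<open>A paired cycle of \<open>i\<close> and \<open>- i\<close> is not among the
      reflections; a point sent to its negative calls for a sign change instead.\<close>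
    define t where "t = (if j = - i then sign_change i else paired_cycle i j)"
    have t: "t \<in> reflections n"
      using i j paired_cycle_in_reflections[of i n j] sign_change_in_reflections[of i n]
      by (auto simp: t_def j_def)
    have t_apply: "t j = i" "\<And>k. \<lbrakk>k \<noteq> i; k \<noteq> - i; k \<noteq> j; k \<noteq> - j\<rbrakk> \<Longrightarrow> t k = k"
      using nz i by (auto simp: t_def sign_change_apply paired_cycle_apply j_def)
    have "t (w k) = k" if k: "w k = k" for k
    proof -
      have "k \<noteq> i" "k \<noteq> - i" using k i odd[of i] by auto
      moreover from this have "k \<noteq> j" "k \<noteq> - j" using k inj[of k i] inj[of k "- i"] odd[of i]
        by (auto simp: j_def)
      ultimately show ?thesis using k t_apply by simp
    qed
    then have "{k \<in> signed_set n. (t \<circ> w) k \<noteq> k} \<subset> {k \<in> signed_set n. w k \<noteq> k}"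
      using i t_apply(1) by (auto simp: j_def)
    then have "card {k \<in> signed_set n. (t \<circ> w) k \<noteq> k} < card {k \<in> signed_set n. w k \<noteq> k}"
      by (intro psubset_card_mono) (simp add: finite_signed_set)
    moreover have "t \<circ> w \<in> hyperoctahedral n"
      using t reflections_subset less.prems by (intro hyperoctahedral_comp) auto
    ultimately obtain ts where "set ts \<subseteq> reflections n" "composition ts = t \<circ> w"
      using less.hyps by blast
    then show ?thesis
      using t by (intro exI[of _ "t # ts"]) (auto simp: fun_eq_iff reflection_involution)
  qed
qed

lemma ex_reduced_word:
  assumes "w \<in> hyperoctahedral n"
  shows "\<exists>ts. length ts = abs_length n w \<and> set ts \<subseteq> reflections n \<and> composition ts = w"
proof -
  have "\<exists>k ts. length ts = k \<and> set ts \<subseteq> reflections n \<and> composition ts = w"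
    using ex_word[OF assms] by blast
  then show ?thesis
    unfolding abs_length_def by (rule LeastI_ex)
qed

lemma abs_length_comp_le:
  assumes "u \<in> hyperoctahedral n" "v \<in> hyperoctahedral n"
  shows "abs_length n (u \<circ> v) \<le> abs_length n u + abs_length n v"
proof -
  obtain xs ys where "length xs = abs_length n u" "set xs \<subseteq> reflections n" "composition xs = u"
    "length ys = abs_length n v" "set ys \<subseteq> reflections n" "composition ys = v"
    using ex_reduced_word[OF assms(1)] ex_reduced_word[OF assms(2)] by blast
  then show ?thesis
    using abs_length_le[of "xs @ ys" n] by (simp add: composition_append)
qed

lemma abs_length_id: "abs_length n id = 0"
  using abs_length_le[of "[]" n] by simp

lemma abs_length_eq_0D: "\<lbrakk>w \<in> hyperoctahedral n; abs_length n w = 0\<rbrakk> \<Longrightarrow> w = id"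
  using ex_reduced_word[of w n] by auto

section \<open>The product of all sign changes as a central element\<close>

lemma all_sign_changes_apply:
  "all_sign_changes n k = (if k \<in> signed_set n then - k else k)"
proof (induction n arbitrary: k)
  case 0
  then show ?case by (auto simp: all_sign_changes_def signed_set_def)
next
  case (Suc n)
  have "[1..int (Suc n)] = [1..int n] @ [int (Suc n)]"
    using upto_rec2[of 1 "int (Suc n)"] by simp
  then have "all_sign_changes (Suc n) k = all_sign_changes n (sign_change (int (Suc n)) k)"
    by (simp add: all_sign_changes_def composition_append)
  then show ?case
    unfolding Suc.IH by (auto simp: sign_change_apply signed_set_def)
qed

lemma all_sign_changes_word:
  "\<exists>ts. set ts \<subseteq> reflections n \<and> composition ts = all_sign_changes n \<and> length ts = n"
  by (rule exI[of _ "map sign_change [1..int n]"])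
     (auto simp: all_sign_changes_def reflections_def)

lemma all_sign_changes_in: "all_sign_changes n \<in> hyperoctahedral n"
  using all_sign_changes_word composition_in_hyperoctahedral by metis

lemma all_sign_changes_central:
  assumes "w \<in> hyperoctahedral n"
  shows "w \<circ> all_sign_changes n = all_sign_changes n \<circ> w"
proof
  fix k
  have "w k \<in> signed_set n \<longleftrightarrow> k \<in> signed_set n"
    using hyperoctahedral_outside[OF assms] hyperoctahedral_bij[OF assms]
    by (metis bij_is_inj injD)
  then show "(w \<circ> all_sign_changes n) k = (all_sign_changes n \<circ> w) k"
    using hyperoctahedral_odd[OF assms] by (simp add: all_sign_changes_apply)
qed

section \<open>Odd functions modulo three\<close>

text \<open>Counting odd functions into the field with three elements replaces the dimension of fixed
  spaces: each reflection cuts the number of fixed functions by a factor of at most three, and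
  an element is an involution once its eigenspaces for \<open>1\<close> and \<open>-1\<close> exhaust everything.\<close>

definition odd_funs :: "nat \<Rightarrow> (int \<Rightarrow> 3) set" where
  "odd_funs n = {f. (\<forall>k. f (- k) = - f k) \<and> (\<forall>k. k \<notin> signed_set n \<longrightarrow> f k = 0)}"

text \<open>Two is invertible modulo three; this keeps the eigenspaces for 1 and -1 apart.\<close>

lemma double_eq_0_mod_3: "x + x = 0 \<Longrightarrow> x = (0 :: 3)"
proof -
  assume "x + x = 0"
  moreover have "(3 :: 3) = 0" by simp
  then have "x + x + x = 0" by (metis mult_zero_left numeral_Bit1 numeral_One distrib_right mult_1)
  ultimately show "x = 0" by simp
qed

lemma card_odd_funs: "card (odd_funs n) = 3 ^ n" and finite_odd_funs: "finite (odd_funs n)"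
proof -
  let ?D = "{1..int n} \<rightarrow>\<^sub>E (UNIV :: 3 set)"
  define ext :: "(int \<Rightarrow> 3) \<Rightarrow> int \<Rightarrow> 3"
    where "ext = (\<lambda>g k. if k \<in> {1..int n} then g k else if - k \<in> {1..int n} then - g (- k) else 0)"
  have "odd_funs n = ext ` ?D"
  proof (intro equalityI subsetI)
    fix f assume f: "f \<in> odd_funs n"
    have "f = ext (restrict f {1..int n})"
    proof
      fix k
      show "f k = ext (restrict f {1..int n}) k"
        using f by (auto simp: ext_def odd_funs_def signed_set_def)
    qed
    then show "f \<in> ext ` ?D"
      by (intro image_eqI[where x = "restrict f {1..int n}"]) auto
  next
    fix f assume "f \<in> ext ` ?D"
    then show "f \<in> odd_funs n"
      by (auto simp: ext_def odd_funs_def signed_set_def)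
  qed
  moreover have "inj_on ext ?D"
  proof (rule inj_onI)
    fix g h assume gh: "g \<in> ?D" "h \<in> ?D" and eq: "ext g = ext h"
    show "g = h"
    proof (rule PiE_ext[OF gh])
      fix k assume "k \<in> {1..int n}"
      then show "g k = h k" using fun_cong[OF eq, of k] by (simp add: ext_def)
    qed
  qed
  ultimately have "card (odd_funs n) = card ?D" by (simp add: card_image)
  also have "\<dots> = 3 ^ n" by (simp add: card_PiE)
  finally show "card (odd_funs n) = 3 ^ n" .
  then show "finite (odd_funs n)" by (simp add: card_ge_0_finite)
qed

text \<open>The counting form of the fact that \<open>k\<close> linear equations cut out a subspace
  of codimension at most \<open>k\<close>: invariance under one reflection follows from a single
  equation \<open>f a = f b\<close>.\<close>

lemma card_fixed_ge:
  assumes "set ts \<subseteq> reflections n"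
  shows "3 ^ n \<le> card {f \<in> odd_funs n. \<forall>t\<in>set ts. f \<circ> t = f} * 3 ^ length ts"
  using assms
proof (induction ts)
  case Nil
  then show ?case by (simp add: card_odd_funs)
next
  case (Cons t ts)
  let ?D = "{f \<in> odd_funs n. \<forall>t\<in>set ts. f \<circ> t = f}"
  obtain a b where ab: "\<And>f. \<lbrakk>f \<in> odd_funs n; f a = f b\<rbrakk> \<Longrightarrow> f \<circ> t = f"
  proof -
    have "t \<in> reflections n" using Cons.prems by simp
    then show ?thesis
    proof (cases rule: reflections_cases)
      case (sign i)
      then have "f \<circ> t = f" if "f \<in> odd_funs n" "f i = f (- i)" for f
        using that by (auto simp: fun_eq_iff sign_change_apply)
      then show ?thesis by (rule that)
    next
      case (pair a b)
      then have "a \<noteq> 0" "b \<noteq> 0" by (auto simp: signed_set_def)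
      then have "f \<circ> t = f" if "f \<in> odd_funs n" "f a = f b" for f
        using that pair by (auto simp: fun_eq_iff paired_cycle_apply odd_funs_def)
      then show ?thesis by (rule that)
    qed
  qed
  let ?K = "{f \<in> ?D. f a = f b}"
  have fin: "finite ?D" using finite_odd_funs by simp
  \<comment> \<open>Subtracting a fixed member of a fibre of \<open>f a - f b\<close> embeds that
    fibre into the kernel \<open>?K\<close>. With three possible values, the kernel holds at least a
    third of \<open>?D\<close>.\<close>
  have fibre: "card {f \<in> ?D. f a - f b = x} \<le> card ?K" for x
  proof (cases "{f \<in> ?D. f a - f b = x} = {}")
    case False
    then obtain g where g: "g \<in> ?D" "g a - g b = x" by blast
    have "(\<lambda>f k. f k - g k) ` {f \<in> ?D. f a - f b = x} \<subseteq> ?K"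
      using g by (auto simp: odd_funs_def fun_eq_iff algebra_simps)
    moreover have "inj_on (\<lambda>f k. f k - g k) {f \<in> ?D. f a - f b = x}"
      by (auto simp: inj_on_def fun_eq_iff)
    ultimately show ?thesis
      using finite_odd_funs by (intro card_inj_on_le) auto
  next
    case True
    then show ?thesis by (simp only: card.empty zero_le)
  qed
  have "?D = (\<Union>x\<in>UNIV. {f \<in> ?D. f a - f b = x})" by auto
  then have "card ?D \<le> (\<Sum>x\<in>UNIV. card {f \<in> ?D. f a - f b = x})"
    using card_UN_le[of UNIV "\<lambda>x. {f \<in> ?D. f a - f b = x}"] by simp
  also have "\<dots> \<le> (\<Sum>x\<in>(UNIV :: 3 set). card ?K)"
    by (intro sum_mono fibre)
  also have "\<dots> = 3 * card ?K" by simp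
  also have "card ?K \<le> card {f \<in> odd_funs n. \<forall>t'\<in>set (t # ts). f \<circ> t' = f}"
    using ab finite_odd_funs by (intro card_mono) auto
  finally have "card ?D \<le> 3 * card {f \<in> odd_funs n. \<forall>t'\<in>set (t # ts). f \<circ> t' = f}" by simp
  then have "card ?D * 3 ^ length ts
      \<le> card {f \<in> odd_funs n. \<forall>t'\<in>set (t # ts). f \<circ> t' = f} * 3 ^ length (t # ts)"
    by (simp add: mult.commute mult.left_commute)
  moreover have "3 ^ n \<le> card ?D * 3 ^ length ts"
    using Cons.prems by (intro Cons.IH) simp
  ultimately show ?case by (rule order_trans[rotated])
qed

lemma card_fixed_ge_abs_length:
  assumes "w \<in> hyperoctahedral n"
  shows "3 ^ n \<le> card {f \<in> odd_funs n. f \<circ> w = f} * 3 ^ abs_length n w"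
proof -
  obtain ts where ts: "length ts = abs_length n w" "set ts \<subseteq> reflections n" "composition ts = w"
    using ex_reduced_word[OF assms] by blast
  have "f \<circ> composition ts = f" if "\<forall>t\<in>set ts. f \<circ> t = f" for f :: "int \<Rightarrow> 3"
    using that by (induction ts) (auto simp: comp_assoc[symmetric])
  then have "card {f \<in> odd_funs n. \<forall>t\<in>set ts. f \<circ> t = f} \<le> card {f \<in> odd_funs n. f \<circ> w = f}"
    using finite_odd_funs ts by (intro card_mono) auto
  from order_trans[OF card_fixed_ge[OF ts(2)] mult_le_mono1[OF this, of "3 ^ length ts"]]
  show ?thesis by (simp only: ts(1))
qed

text \<open>Only the zero function is both odd and invariant under -1, so the bound on fixed
  functions reads \<open>3 ^ n\<close> at most \<open>3\<close> to the length.\<close>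

lemma abs_length_all_sign_changes: "abs_length n (all_sign_changes n) = n"
proof (rule antisym)
  show "abs_length n (all_sign_changes n) \<le> n"
    using all_sign_changes_word abs_length_le by metis
  have "f k = 0" if f: "f \<in> odd_funs n" "f \<circ> all_sign_changes n = f" for f k
  proof (cases "k \<in> signed_set n")
    case True
    have "(f \<circ> all_sign_changes n) k = f k" by (simp only: f(2))
    then have "- f k = f k"
      using True f(1) by (simp add: all_sign_changes_apply odd_funs_def)
    then have "f k + f k = 0" by (metis add.left_inverse)
    then show ?thesis by (rule double_eq_0_mod_3)
  qed (use f in \<open>auto simp: odd_funs_def\<close>)
  then have "{f \<in> odd_funs n. f \<circ> all_sign_changes n = f} \<subseteq> {\<lambda>_. 0}" by auto
  from card_mono[OF _ this] have "card {f \<in> odd_funs n. f \<circ> all_sign_changes n = f} \<le> 1"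
    by simp
  from order_trans[OF card_fixed_ge_abs_length[OF all_sign_changes_in] mult_le_mono1[OF this]]
  have "(3 :: nat) ^ n \<le> 3 ^ abs_length n (all_sign_changes n)" by simp
  then show "n \<le> abs_length n (all_sign_changes n)" by simp
qed

text \<open>The pairs of a \<open>u\<close>-fixed and a \<open>u\<close>-negated odd function number
  at least \<open>3 ^ n\<close>, and addition is injective on them, so every odd function is such a
  sum. Hence \<open>u \<circ> u\<close> leaves every odd function invariant, and one that separates
  \<open>i\<close> from all other points gives the claim.\<close>

lemma involution_if_below_all_sign_changes:
  assumes u: "u \<in> hyperoctahedral n"
    and le: "abs_length n u + abs_length n (inv u \<circ> all_sign_changes n) \<le> n"
  shows "u (u i) = i"
proof (cases "i \<in> signed_set n")
  case False
  then show ?thesis using hyperoctahedral_outside[OF u] by simp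
next
  case True
  define c where "c = all_sign_changes n"
  define x where "x = inv u \<circ> c"
  have x: "x \<in> hyperoctahedral n"
    using u by (simp add: x_def c_def hyperoctahedral_comp hyperoctahedral_inv all_sign_changes_in)
  have xu: "x \<circ> u = c"
    using all_sign_changes_central[OF u] inv_comp_comp[OF u, of c]
    by (simp add: x_def c_def comp_assoc)
  let ?F = "{f \<in> odd_funs n. f \<circ> u = f}"
  let ?N = "{f \<in> odd_funs n. \<forall>k. f (u k) = - f k}"
  let ?add = "\<lambda>(g, h) k. g k + h k :: 3"
  have fc: "f (c k) = - f k" if "f \<in> odd_funs n" for f k
    using that by (auto simp: c_def all_sign_changes_apply odd_funs_def)
  \<comment> \<open>As \<open>x \<circ> u = c\<close> and \<open>c\<close> negates odd functions,
    invariance under \<open>x\<close> means negation under \<open>u\<close>; thus the bound for the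
    length of \<open>x\<close> becomes a bound for \<open>?N\<close>.\<close>
  have "{f \<in> odd_funs n. f \<circ> x = f} \<subseteq> ?N"
  proof clarify
    fix f k assume f: "f \<in> odd_funs n" "f \<circ> x = f"
    have "f (u k) = f (x (u k))" using fun_cong[OF f(2), of "u k"] by simp
    also have "\<dots> = - f k" using fun_cong[OF xu, of k] fc[OF f(1)] by simp
    finally show "f (u k) = - f k" .
  qed
  then have "card {f \<in> odd_funs n. f \<circ> x = f} \<le> card ?N"
    using finite_odd_funs by (intro card_mono) auto
  from order_trans[OF card_fixed_ge_abs_length[OF x] mult_le_mono1[OF this]]
  have N: "3 ^ n \<le> card ?N * 3 ^ abs_length n x" .
  have F: "3 ^ n \<le> card ?F * 3 ^ abs_length n u"
    by (rule card_fixed_ge_abs_length[OF u])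
  have "3 ^ n * 3 ^ n \<le> (card ?F * 3 ^ abs_length n u) * (card ?N * 3 ^ abs_length n x)"
    by (rule mult_le_mono[OF F N])
  also have "\<dots> = card ?F * card ?N * 3 ^ (abs_length n u + abs_length n x)"
    by (simp add: power_add)
  also have "\<dots> \<le> card ?F * card ?N * 3 ^ n"
    using le by (intro mult_le_mono2 power_increasing) (auto simp: x_def c_def)
  finally have big: "3 ^ n \<le> card (?F \<times> ?N)" by (simp add: card_cartesian_product)
  have "inj_on ?add (?F \<times> ?N)"
  proof (rule inj_onI, clarify)
    fix g h g' h' assume g: "g \<circ> u = g" "g' \<circ> u = g'"
      and h: "\<forall>k. h (u k) = - h k" "\<forall>k. h' (u k) = - h' k"
      and eq: "(\<lambda>k. g k + h k) = (\<lambda>k. g' k + h' k :: 3)"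
    have "g k = g' k" for k
    proof -
      have 1: "g k + h k = g' k + h' k" using fun_cong[OF eq, of k] by simp
      have "g (u k) + h (u k) = g' (u k) + h' (u k)" using fun_cong[OF eq, of "u k"] by simp
      then have 2: "g k - h k = g' k - h' k"
        using fun_cong[OF g(1), of k] fun_cong[OF g(2), of k] h by simp
      have "(g k - g' k) + (g k - g' k) = (g k + h k) + (g k - h k) - (g' k + h' k) - (g' k - h' k)"
        by (simp add: algebra_simps)
      also have "\<dots> = 0" unfolding 1 2 by (simp add: algebra_simps)
      finally show ?thesis using double_eq_0_mod_3 by (metis eq_iff_diff_eq_0)
    qed
    moreover from this have "h k = h' k" for k using fun_cong[OF eq, of k] by simp
    ultimately show "g = g' \<and> h = h'" by auto
  qed
  then have "card (?add ` (?F \<times> ?N)) \<ge> card (odd_funs n)"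
    using big by (simp add: card_image card_odd_funs)
  moreover have "?add ` (?F \<times> ?N) \<subseteq> odd_funs n"
    by (auto simp: odd_funs_def)
  ultimately have all: "?add ` (?F \<times> ?N) = odd_funs n"
    using card_seteq[OF finite_odd_funs] by blast
  \<comment> \<open>The odd function supported at \<open>i\<close> and \<open>- i\<close>. It takes
    the value 1 at \<open>i\<close> only, because 1 and -1 differ modulo three.\<close>
  define d :: "int \<Rightarrow> 3" where "d = (\<lambda>k. if k = i then 1 else if k = - i then - 1 else 0)"
  have "i \<noteq> 0" using True by (simp add: signed_set_def)
  then have "d \<in> odd_funs n"
    using True by (auto simp: d_def odd_funs_def signed_set_def)
  then have "d \<in> ?add ` (?F \<times> ?N)" unfolding all .
  then obtain g h where "g \<circ> u = g" "\<forall>k. h (u k) = - h k" and d: "d = (\<lambda>k. g k + h k)"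
    by auto
  then have "d (u (u i)) = d i"
    by (metis comp_apply minus_minus)
  moreover have "(1 :: 3) \<noteq> - 1"
    using double_eq_0_mod_3[of 1] by (metis add.left_inverse zero_neq_one)
  ultimately show ?thesis by (auto simp: d_def split: if_splits)
qed

section \<open>The interval as a poset of involutions\<close>

definition signed_involutions :: "nat \<Rightarrow> (int \<Rightarrow> int) set" where
  "signed_involutions n =
     {w. (\<forall>i. w (w i) = i) \<and> (\<forall>i. w (- i) = - w i) \<and> (\<forall>i. i \<notin> signed_set n \<longrightarrow> w i = i)}"

lemma signed_involutions_subset: "signed_involutions n \<subseteq> hyperoctahedral n"
proof
  fix w assume w: "w \<in> signed_involutions n"
  then have "bij w" by (intro o_bij[of w]) (auto simp: signed_involutions_def fun_eq_iff)
  then show "w \<in> hyperoctahedral n"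
    using w by (simp add: hyperoctahedral_iff signed_involutions_def)
qed

lemma finite_signed_involutions: "finite (signed_involutions n)"
proof (rule finite_subset)
  show "signed_involutions n \<subseteq> {w. w permutes signed_set n}"
    using signed_involutions_subset by (auto simp: hyperoctahedral_def)
qed (simp add: finite_permutations finite_signed_set)

lemma involution_involution: "w \<in> signed_involutions n \<Longrightarrow> w (w i) = i"
  and involution_odd: "w \<in> signed_involutions n \<Longrightarrow> w (- i) = - w i"
  and involution_outside: "\<lbrakk>w \<in> signed_involutions n; i \<notin> signed_set n\<rbrakk> \<Longrightarrow> w i = i"
  by (auto simp: signed_involutions_def)

lemma involution_inv: "w \<in> signed_involutions n \<Longrightarrow> inv w = w"
  by (rule inv_equality) (auto simp: involution_involution)

lemma involution_in_signed_set:
  "\<lbrakk>w \<in> signed_involutions n; i \<in> signed_set n\<rbrakk> \<Longrightarrow> w i \<in> signed_set n"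
  by (metis involution_involution involution_outside)

lemma id_in_signed_involutions: "id \<in> signed_involutions n"
  by (simp add: signed_involutions_def)

text \<open>On involutions this is multiplication by \<open>all_sign_changes n\<close>, as
  \<open>negate_eq_comp\<close> shows; it reverses the order and later turns meets into
  joins.\<close>

definition negate :: "nat \<Rightarrow> (int \<Rightarrow> int) \<Rightarrow> int \<Rightarrow> int" where
  "negate n w = (\<lambda>i. if i \<in> signed_set n then - w i else i)"

lemma signed_set_uminus: "- i \<in> signed_set n \<longleftrightarrow> i \<in> signed_set n"
  by (auto simp: signed_set_def)

lemma negate_in_signed_involutions:
  assumes "w \<in> signed_involutions n"
  shows "negate n w \<in> signed_involutions n"
  using assms involution_in_signed_set[OF assms]
  by (auto simp: negate_def signed_involutions_def signed_set_uminus)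

lemma negate_eq_comp: "w \<in> signed_involutions n \<Longrightarrow> negate n w = w \<circ> all_sign_changes n"
  by (auto simp: negate_def fun_eq_iff all_sign_changes_apply involution_odd involution_outside)

lemma all_sign_changes_eq_negate: "all_sign_changes n = negate n id"
  by (auto simp: negate_def fun_eq_iff all_sign_changes_apply)

text \<open>Twice the contribution of a point to the codimension of the fixed space.\<close>

definition point_weight :: "(int \<Rightarrow> int) \<Rightarrow> int \<Rightarrow> nat" where
  "point_weight w i = (if w i = i then 0 else if w i = - i then 2 else 1)"

section \<open>Lengths of involutions\<close>

text \<open>Each letter removes one block of \<open>w\<close>, either a negated point of weight 2 or
  two paired points of weight 1 each.\<close>

lemma involution_word:
  assumes "w \<in> signed_involutions n"
  shows "\<exists>ts. set ts \<subseteq> reflections n \<and> composition ts = w \<and>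
    2 * length ts = (\<Sum>i=1..int n. point_weight w i)"
  using assms
proof (induction "\<Sum>i=1..int n. point_weight w i" arbitrary: w rule: less_induct)
  case less
  note inv = involution_involution[OF less.prems]
    and odd = involution_odd[OF less.prems]
    and outside = involution_outside[OF less.prems]
  show ?case
  proof (cases "\<exists>i\<in>{1..int n}. w i \<noteq> i")
    case False
    have fix_pt: "w i = i" for i
    proof (cases "i \<in> signed_set n")
      case True
      then have "i \<in> {1..int n} \<or> - i \<in> {1..int n}" by (auto simp: signed_set_def)
      then show ?thesis using False odd[of i] by auto
    qed (rule outside)
    then have "w = id" by auto
    then show ?thesis by (intro exI[of _ "[]"]) (auto simp: point_weight_def)
  next
    case True
    then obtain i where i: "i \<in> {1..int n}" "w i \<noteq> i" by blast
    define j where "j = w i"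
    have wj: "w j = i" by (simp add: j_def inv)
    have "i \<in> signed_set n" using i by (auto simp: signed_set_def)
    have j: "j \<in> signed_set n"
      using involution_in_signed_set[OF less.prems \<open>i \<in> signed_set n\<close>] by (simp add: j_def)
    have nz: "i \<noteq> 0" "j \<noteq> 0" using i j by (auto simp: signed_set_def)
    have w_other: "w k \<noteq> i \<and> w k \<noteq> - i \<and> w k \<noteq> j \<and> w k \<noteq> - j"
      if "k \<noteq> i" "k \<noteq> - i" "k \<noteq> j" "k \<noteq> - j" for k
      using that inv[of k] odd[of i] odd[of j] wj by (metis j_def)
    define t where "t = (if j = - i then sign_change i else paired_cycle i j)"
    define w' where "w' = (\<lambda>k. if k \<in> {i, - i, j, - j} then k else w k)"
    have t: "t \<in> reflections n"
      using i j \<open>i \<in> signed_set n\<close> paired_cycle_in_reflections[of i n j] sign_change_in_reflections[of i n]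
      by (auto simp: t_def j_def)
    have tw: "t (w' k) = w k" for k
    proof (cases "k \<in> {i, - i, j, - j}")
      case True
      then show ?thesis
        using nz i wj odd[of i] odd[of j]
        by (auto simp: w'_def t_def sign_change_apply paired_cycle_apply j_def)
    next
      case False
      then show ?thesis
        using w_other[of k] nz i
        by (auto simp: w'_def t_def sign_change_apply paired_cycle_apply j_def)
    qed
    have w': "w' \<in> signed_involutions n"
      using inv odd outside w_other \<open>i \<in> signed_set n\<close> j
      by (auto simp: signed_involutions_def w'_def)
    define A where "A = {1..int n} - {i, \<bar>j\<bar>}"
    have A: "{1..int n} = A \<union> {i, \<bar>j\<bar>}" "finite A" "i \<notin> A" "\<bar>j\<bar> \<notin> A"
      using i j by (auto simp: A_def signed_set_def)
    have split: "(\<Sum>k=1..int n. f k) = (\<Sum>k\<in>A. f k) + (\<Sum>k\<in>{i, \<bar>j\<bar>}. f k)" for f :: "int \<Rightarrow> nat"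
      unfolding A(1) using A by (intro sum.union_disjoint) auto
    have "(\<Sum>k\<in>A. point_weight w' k) = (\<Sum>k\<in>A. point_weight w k)"
      using i by (intro sum.cong) (auto simp: A_def point_weight_def w'_def)
    \<comment> \<open>For \<open>j = - i\<close> the set \<open>{i, \<bar>j\<bar>}\<close> is a
      singleton of weight 2; otherwise it has two points of weight 1.\<close>
    moreover have "(\<Sum>k\<in>{i, \<bar>j\<bar>}. point_weight w k) = 2"
    proof (cases "j = - i")
      case True
      then show ?thesis using i nz by (simp add: point_weight_def j_def[symmetric])
    next
      case False
      then have "i \<noteq> \<bar>j\<bar>" using i by (auto simp: j_def abs_if split: if_splits)
      then show ?thesis
        using False i wj odd[of j] by (auto simp: point_weight_def j_def[symmetric] abs_if)
    qed
    moreover have "(\<Sum>k\<in>{i, \<bar>j\<bar>}. point_weight w' k) = 0"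
      by (intro sum.neutral) (auto simp: point_weight_def w'_def abs_if)
    ultimately have sum: "(\<Sum>k=1..int n. point_weight w k) = (\<Sum>k=1..int n. point_weight w' k) + 2"
      unfolding split by simp
    then obtain ts where ts: "set ts \<subseteq> reflections n" "composition ts = w'"
      "2 * length ts = (\<Sum>i=1..int n. point_weight w' i)"
      using less.hyps[of w'] w' by auto
    then have "set (t # ts) \<subseteq> reflections n" "composition (t # ts) = w"
      "2 * length (t # ts) = (\<Sum>i=1..int n. point_weight w i)"
      using t tw sum by (auto simp: fun_eq_iff)
    then show ?thesis by blast
  qed
qed

text \<open>The weights of \<open>w\<close> and of its product with the central element add up to 2
  at every point, so the upper bounds from words add up to \<open>n\<close>. Subadditivity bounds
  the sum of both lengths from below by the length \<open>n\<close> of the central element, so both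
  upper bounds are attained.\<close>

lemma abs_length_involution_and_negate:
  assumes w: "w \<in> signed_involutions n"
  shows "2 * abs_length n w = (\<Sum>i=1..int n. point_weight w i)"
    and "abs_length n w + abs_length n (w \<circ> all_sign_changes n) = n"
proof -
  define x where "x = w \<circ> all_sign_changes n"
  have x: "x = negate n w" "x \<in> signed_involutions n"
    using w by (auto simp: x_def negate_eq_comp[symmetric] negate_in_signed_involutions)
  have upper: "2 * abs_length n v \<le> (\<Sum>i=1..int n. point_weight v i)"
    if "v \<in> signed_involutions n" for v
    using involution_word[OF that] abs_length_le[of _ n] by fastforce
  have "point_weight w i + point_weight x i = 2" if "i \<in> {1..int n}" for i
    using that by (auto simp: point_weight_def x negate_def signed_set_def)
  then have "(\<Sum>i=1..int n. point_weight w i + point_weight x i) = (\<Sum>i=1..int n. 2)"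
    by (intro sum.cong) auto
  then have total: "(\<Sum>i=1..int n. point_weight w i) + (\<Sum>i=1..int n. point_weight x i) = 2 * n"
    by (simp add: sum.distrib)
  have "w \<circ> x = all_sign_changes n"
    by (auto simp: x_def fun_eq_iff involution_involution[OF w])
  then have "n \<le> abs_length n w + abs_length n x"
    using abs_length_comp_le[of w n x] w x signed_involutions_subset
    by (auto simp: abs_length_all_sign_changes)
  then show "2 * abs_length n w = (\<Sum>i=1..int n. point_weight w i)"
    and "abs_length n w + abs_length n (w \<circ> all_sign_changes n) = n"
    using upper[OF w] upper[OF x(2)] total by (auto simp: x_def[symmetric])
qed

lemma carrier_L_interval: "carrier (L_interval n) = signed_involutions n"
proof (intro equalityI subsetI)
  fix u assume "u \<in> carrier (L_interval n)"
  then have u: "u \<in> hyperoctahedral n"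
    and "abs_length n u + abs_length n (inv u \<circ> all_sign_changes n) = n"
    by (auto simp: L_interval_def at_least_at_most_def Abs_order_def abs_length_all_sign_changes)
  then show "u \<in> signed_involutions n"
    using involution_if_below_all_sign_changes[of u n] hyperoctahedral_odd[OF u]
      hyperoctahedral_outside[OF u] by (simp add: signed_involutions_def)
next
  fix u assume "u \<in> signed_involutions n"
  then show "u \<in> carrier (L_interval n)"
    using signed_involutions_subset abs_length_involution_and_negate(2)[of u n]
    by (auto simp: L_interval_def at_least_at_most_def Abs_order_def abs_length_all_sign_changes
        involution_inv abs_length_id)
qed

lemma le_L_interval:
  "le (L_interval n) u v \<longleftrightarrow> abs_length n u + abs_length n (inv u \<circ> v) = abs_length n v"
  by (simp add: L_interval_def Abs_order_def)

text \<open>Below an involution, the sign changes may be split into arbitrary involutions, whereas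
  each pair is either kept or fixed pointwise.\<close>

definition block_le :: "(int \<Rightarrow> int) \<Rightarrow> (int \<Rightarrow> int) \<Rightarrow> bool" where
  "block_le u v \<longleftrightarrow> (\<forall>i. v i = - i \<or> u i = i \<or> u i = v i)"

text \<open>The pointwise form of subadditivity together with its equality case; summation over the
  points then reduces the order to a condition on each single point.\<close>

lemma point_weight_triangle:
  assumes u: "u \<in> signed_involutions n" and v: "v \<in> signed_involutions n"
    and comm: "u (v i) = v (u i)" and "i \<noteq> 0"
  shows "point_weight v i \<le> point_weight u i + point_weight (u \<circ> v) i"
    and "point_weight v i = point_weight u i + point_weight (u \<circ> v) i
      \<longleftrightarrow> v i = - i \<or> u i = i \<or> u i = v i"
proof -
  note facts = involution_involution[OF u] involution_odd[OF u]
    involution_involution[OF v] involution_odd[OF v]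
  have "point_weight v i \<le> point_weight u i + point_weight (u \<circ> v) i \<and>
    (point_weight v i = point_weight u i + point_weight (u \<circ> v) i
      \<longleftrightarrow> v i = - i \<or> u i = i \<or> u i = v i)"
  proof -
    consider "v i = i" | "v i = - i" | "v i \<noteq> i" "v i \<noteq> - i" "u i = i"
      | "v i \<noteq> i" "v i \<noteq> - i" "u i = - i" | "v i \<noteq> i" "v i \<noteq> - i" "u i = v i"
      | "v i \<noteq> i" "v i \<noteq> - i" "u i = - v i"
      | "v i \<noteq> i" "v i \<noteq> - i" "u i \<noteq> i" "u i \<noteq> - i" "u i \<noteq> v i" "u i \<noteq> - v i" by blast
    then show ?thesis
    proof cases
      case 1
      then show ?thesis using \<open>i \<noteq> 0\<close> by (simp add: point_weight_def)
    next
      case 2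
      moreover have "u (v i) = - u i" using 2 facts(2)[of i] by simp
      ultimately show ?thesis using \<open>i \<noteq> 0\<close> by (auto simp: point_weight_def)
    next
      case 3
      then show ?thesis using comm by (simp add: point_weight_def)
    next
      case 4
      moreover have "u (v i) = - v i" using 4 comm facts(4)[of i] by simp
      ultimately show ?thesis using \<open>i \<noteq> 0\<close> by (auto simp: point_weight_def)
    next
      case 5
      moreover have "u (v i) = i" using 5 facts(1)[of i] by simp
      ultimately show ?thesis by (auto simp: point_weight_def)
    next
      case 6
      moreover have "u (v i) = - i" using 6 facts(1)[of i] facts(2)[of "v i"] by simp
      moreover have "v i \<noteq> 0" using facts(3)[of i] facts(4)[of 0] \<open>i \<noteq> 0\<close> by auto
      ultimately show ?thesis using \<open>i \<noteq> 0\<close> by (auto simp: point_weight_def)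
    next
      case 7
      moreover have "u (v i) \<noteq> i" using 7 facts(1)[of "v i"] by auto
      ultimately show ?thesis by (simp add: point_weight_def)
    qed
  qed
  then show "point_weight v i \<le> point_weight u i + point_weight (u \<circ> v) i"
    and "point_weight v i = point_weight u i + point_weight (u \<circ> v) i
      \<longleftrightarrow> v i = - i \<or> u i = i \<or> u i = v i"
    by auto
qed

text \<open>With \<open>c\<close> the central element \<open>[1][2]...[n]\<close> and \<open>c = u x y\<close> a factorization with additive
  lengths, also \<open>c = x y u\<close>, so that \<open>x\<close> lies below \<open>c\<close> too and is an involution.\<close>

lemma quotient_in_signed_involutions:
  assumes u: "u \<in> signed_involutions n" and v: "v \<in> signed_involutions n"
    and le: "abs_length n u + abs_length n (u \<circ> v) = abs_length n v"
  shows "u \<circ> v \<in> signed_involutions n"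
proof -
  define c where "c = all_sign_changes n"
  define x where "x = u \<circ> v"
  define y where "y = v \<circ> c"
  have h: "u \<in> hyperoctahedral n" "v \<in> hyperoctahedral n" "c \<in> hyperoctahedral n"
    using u v signed_involutions_subset all_sign_changes_in by (auto simp: c_def)
  then have hx: "x \<in> hyperoctahedral n" and hy: "y \<in> hyperoctahedral n"
    by (auto simp: x_def y_def intro: hyperoctahedral_comp)
  have "x \<circ> (y \<circ> u) = c"
  proof
    fix k
    have "c (u k) = u (c k)"
      using fun_cong[OF all_sign_changes_central[OF h(1)], of k] by (simp add: c_def)
    then show "(x \<circ> (y \<circ> u)) k = c k"
      by (simp add: x_def y_def involution_involution[OF u] involution_involution[OF v])
  qed
  then have "inv x \<circ> c = y \<circ> u"
    using inv_comp_comp[OF hx, of "y \<circ> u"] by simp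
  moreover have "abs_length n (y \<circ> u) \<le> abs_length n y + abs_length n u"
    by (rule abs_length_comp_le[OF hy h(1)])
  moreover have "abs_length n v + abs_length n y = n"
    unfolding y_def c_def by (rule abs_length_involution_and_negate(2)[OF v])
  ultimately have "abs_length n x + abs_length n (inv x \<circ> all_sign_changes n) \<le> n"
    using le by (simp add: x_def c_def)
  from involution_if_below_all_sign_changes[OF hx this]
  show ?thesis
    using hyperoctahedral_odd[OF hx] hyperoctahedral_outside[OF hx]
    by (simp add: signed_involutions_def x_def)
qed

text \<open>If \<open>u \<circ> v\<close> is an involution, then \<open>u\<close> and
  \<open>v\<close> commute, and equality of the summed weights forces equality at every point. Each
  side of the claim implies that premise: the order by
  \<open>quotient_in_signed_involutions\<close>, \<open>block_le\<close> by direct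
  verification.\<close>

lemma le_L_interval_iff_block_le:
  assumes u: "u \<in> signed_involutions n" and v: "v \<in> signed_involutions n"
  shows "le (L_interval n) u v \<longleftrightarrow> block_le u v"
proof -
  note facts = involution_involution[OF u] involution_odd[OF u]
    involution_involution[OF v] involution_odd[OF v]
  have main: "abs_length n u + abs_length n (u \<circ> v) = abs_length n v \<longleftrightarrow> block_le u v"
    if x: "u \<circ> v \<in> signed_involutions n"
  proof -
    have comm: "u (v i) = v (u i)" for i
      using involution_involution[OF x, of i] facts by (metis comp_apply)
    note tri = point_weight_triangle[OF u v comm]
    have "abs_length n u + abs_length n (u \<circ> v) = abs_length n v \<longleftrightarrow>
        2 * abs_length n v = 2 * abs_length n u + 2 * abs_length n (u \<circ> v)" by auto
    also have "\<dots> \<longleftrightarrow> (\<Sum>i=1..int n. point_weight v i)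
        = (\<Sum>i=1..int n. point_weight u i + point_weight (u \<circ> v) i)"
      by (simp only: abs_length_involution_and_negate(1)[OF u] abs_length_involution_and_negate(1)[OF v]
          abs_length_involution_and_negate(1)[OF x] sum.distrib)
    also have "\<dots> \<longleftrightarrow> (\<forall>i\<in>{1..int n}. point_weight v i = point_weight u i + point_weight (u \<circ> v) i)"
    proof
      assume eq: "(\<Sum>i=1..int n. point_weight v i)
        = (\<Sum>i=1..int n. point_weight u i + point_weight (u \<circ> v) i)"
      show "\<forall>i\<in>{1..int n}. point_weight v i = point_weight u i + point_weight (u \<circ> v) i"
        using tri(1) by (intro ballI sum_mono_inv[OF eq]) auto
    qed (intro sum.cong, auto)
    also have "\<dots> \<longleftrightarrow> (\<forall>i\<in>{1..int n}. v i = - i \<or> u i = i \<or> u i = v i)"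
      using tri(2) by (intro ball_cong) auto
    also have "\<dots> \<longleftrightarrow> block_le u v"
    proof
      assume *: "\<forall>i\<in>{1..int n}. v i = - i \<or> u i = i \<or> u i = v i"
      have "v i = - i \<or> u i = i \<or> u i = v i" for i
      proof -
        consider "i \<in> {1..int n}" | "- i \<in> {1..int n}" | "i \<notin> signed_set n"
          by (fastforce simp: signed_set_def)
        then show ?thesis
        proof cases
          case 2
          then show ?thesis using * facts by fastforce
        qed (use * involution_outside[OF u] in auto)
      qed
      then show "block_le u v" by (simp add: block_le_def)
    qed (simp add: block_le_def)
    finally show ?thesis .
  qed
  have "u \<circ> v \<in> signed_involutions n" if "block_le u v"
  proof -
    have "u (v i) = v (u i)" for i
      using that facts unfolding block_le_def by metis
    then show ?thesis
      using u v by (auto simp: signed_involutions_def)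
  qed
  then show ?thesis
    using main quotient_in_signed_involutions[OF u v]
    by (auto simp: le_L_interval involution_inv[OF u])
qed

lemma partial_order_L_interval: "partial_order (L_interval n)"
proof -
  have eq: "eq (L_interval n) = (=)"
    by (simp add: L_interval_def Abs_order_def)
  have refl: "block_le u u" for u by (simp add: block_le_def)
  have antisym: "u = v" if "block_le u v" "block_le v u" "u \<in> signed_involutions n" "v \<in> signed_involutions n" for u v
  proof
    fix i show "u i = v i"
    \<comment> \<open>At 0, being fixed and being negated coincide, so \<open>block_le\<close> says
      nothing there.\<close>
    proof (cases "i = 0")
      case True
      then show ?thesis
        using involution_outside[OF that(3), of 0] involution_outside[OF that(4), of 0]
        by (simp add: signed_set_def)
    next
      case False
      then show ?thesis
        using spec[OF that(1)[unfolded block_le_def], of i] spec[OF that(2)[unfolded block_le_def], of i]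
        by auto
    qed
  qed
  have trans: "block_le u w" if "block_le u v" "block_le v w" "u \<in> signed_involutions n" for u v w
    unfolding block_le_def
  proof
    have "u 0 = 0" using involution_outside[OF that(3), of 0] by (simp add: signed_set_def)
    then show "w i = - i \<or> u i = i \<or> u i = w i" for i
      using spec[OF that(1)[unfolded block_le_def], of i] spec[OF that(2)[unfolded block_le_def], of i]
      by (cases "i = 0") auto
  qed
  show ?thesis
    by unfold_locales
      (auto simp: eq carrier_L_interval le_L_interval_iff_block_le refl intro: antisym trans)
qed

section \<open>Meets and joins\<close>

text \<open>The pointwise rule for the greatest lower bound: a common value is kept, a block of one
  involution is kept if the other negates all of its points, and everything else is fixed.\<close>

definition involution_meet :: "(int \<Rightarrow> int) \<Rightarrow> (int \<Rightarrow> int) \<Rightarrow> int \<Rightarrow> int" where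
  "involution_meet u v i =
     (if u i = v i then u i
      else if u i = - i \<and> u (v i) = - v i then v i
      else if v i = - i \<and> v (u i) = - u i then u i
      else i)"

lemma involution_meet_in:
  assumes u: "u \<in> signed_involutions n" and v: "v \<in> signed_involutions n"
  shows "involution_meet u v \<in> signed_involutions n"
proof -
  note facts = involution_involution[OF u] involution_odd[OF u]
    involution_involution[OF v] involution_odd[OF v]
  have "involution_meet u v (involution_meet u v i) = i" for i
    using facts unfolding involution_meet_def by (smt (verit))
  moreover have "involution_meet u v (- i) = - involution_meet u v i" for i
    using facts unfolding involution_meet_def by (smt (verit))
  moreover have "involution_meet u v i = i" if "i \<notin> signed_set n" for i
    using that involution_outside[OF u] involution_outside[OF v] by (simp add: involution_meet_def)
  ultimately show ?thesis by (simp add: signed_involutions_def)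
qed

lemma involution_meet_le: "block_le (involution_meet u v) u" "block_le (involution_meet u v) v"
  by (auto simp: block_le_def involution_meet_def)

text \<open>Where \<open>w\<close> moves \<open>i\<close>, each of \<open>u\<close> and
  \<open>v\<close> negates \<open>i\<close> or agrees with \<open>w\<close> there. The same
  alternatives at \<open>w i\<close> supply the conditions on the partner in
  \<open>involution_meet\<close>.\<close>

lemma involution_meet_greatest:
  assumes u: "u \<in> signed_involutions n" and v: "v \<in> signed_involutions n"
    and w: "w \<in> signed_involutions n" and le: "block_le w u" "block_le w v"
  shows "block_le w (involution_meet u v)"
proof -
  note facts = involution_involution[OF u] involution_involution[OF v] involution_involution[OF w]
  have "involution_meet u v i = - i \<or> w i = i \<or> w i = involution_meet u v i" for i
    using facts spec[OF le(1)[unfolded block_le_def]] spec[OF le(2)[unfolded block_le_def]]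
    unfolding involution_meet_def by (smt (verit))
  then show ?thesis by (simp add: block_le_def)
qed

lemma negate_negate: "w \<in> signed_involutions n \<Longrightarrow> negate n (negate n w) = w"
  by (auto simp: negate_def fun_eq_iff involution_outside)

text \<open>Negation exchanges two of the alternatives at a point, that the larger element negates
  it and that the smaller one fixes it, and preserves the third.\<close>

lemma block_le_negate:
  assumes u: "u \<in> signed_involutions n" and v: "v \<in> signed_involutions n"
  shows "block_le (negate n u) (negate n v) \<longleftrightarrow> block_le v u"
proof -
  have "negate n v i = - i \<or> negate n u i = i \<or> negate n u i = negate n v i
      \<longleftrightarrow> u i = - i \<or> v i = i \<or> v i = u i" for i
    using involution_outside[OF v, of i] by (auto simp: negate_def)
  then show ?thesis by (simp add: block_le_def)
qed

lemma lattice_L_interval: "Lattice.lattice (L_interval n)"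
proof -
  interpret partial_order "L_interval n" by (rule partial_order_L_interval)
  note simps = least_def greatest_def Upper_def Lower_def carrier_L_interval le_L_interval_iff_block_le
  have inf: "\<exists>s. greatest (L_interval n) s (Lower (L_interval n) {u, v})"
    if "u \<in> carrier (L_interval n)" "v \<in> carrier (L_interval n)" for u v
    using that involution_meet_in[of u n v] involution_meet_le[of u v] involution_meet_greatest[of u n v]
    by (intro exI[of _ "involution_meet u v"]) (auto simp: simps)
  have sup: "\<exists>s. least (L_interval n) s (Upper (L_interval n) {u, v})"
    if "u \<in> carrier (L_interval n)" "v \<in> carrier (L_interval n)" for u v
  proof -
    have uv: "u \<in> signed_involutions n" "v \<in> signed_involutions n"
      using that by (auto simp: carrier_L_interval)
    let ?u = "negate n u" and ?v = "negate n v"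
    let ?m = "involution_meet ?u ?v"
    have n: "?u \<in> signed_involutions n" "?v \<in> signed_involutions n" "?m \<in> signed_involutions n"
      using uv by (auto intro!: negate_in_signed_involutions involution_meet_in)
    have "block_le (negate n ?u) (negate n ?m)" "block_le (negate n ?v) (negate n ?m)"
      unfolding block_le_negate[OF n(1,3)] block_le_negate[OF n(2,3)]
      by (rule involution_meet_le)+
    then have "block_le u (negate n ?m)" "block_le v (negate n ?m)"
      using uv by (simp_all add: negate_negate)
    moreover have "block_le (negate n ?m) w"
      if "w \<in> signed_involutions n" "block_le u w" "block_le v w" for w
    proof -
      have "block_le (negate n w) ?m"
        using that uv n
        by (intro involution_meet_greatest[of _ n])
          (auto simp: block_le_negate negate_in_signed_involutions)
      then have "block_le (negate n ?m) (negate n (negate n w))"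
        by (simp only: block_le_negate[OF n(3) negate_in_signed_involutions[OF that(1)]])
      then show ?thesis using that by (simp add: negate_negate)
    qed
    ultimately show ?thesis
      using uv negate_in_signed_involutions[OF n(3)]
      by (intro exI[of _ "negate n ?m"]) (auto simp: simps)
  qed
  show ?thesis by unfold_locales (fact sup, fact inf)
qed

lemma id_least: "u \<in> carrier (L_interval n) \<Longrightarrow> le (L_interval n) id u"
  by (simp add: carrier_L_interval le_L_interval_iff_block_le id_in_signed_involutions block_le_def)

lemma all_sign_changes_in_carrier: "all_sign_changes n \<in> carrier (L_interval n)"
  by (simp add: carrier_L_interval all_sign_changes_eq_negate id_in_signed_involutions
      negate_in_signed_involutions)

lemma all_sign_changes_greatest:
  assumes "u \<in> carrier (L_interval n)"
  shows "le (L_interval n) u (all_sign_changes n)"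
proof -
  have "block_le u (all_sign_changes n)"
    using assms by (auto simp: block_le_def all_sign_changes_apply carrier_L_interval involution_outside)
  then show ?thesis
    using assms all_sign_changes_in_carrier by (simp add: le_L_interval_iff_block_le carrier_L_interval)
qed

lemma bottom_L_interval: "\<bottom>\<^bsub>L_interval n\<^esub> = id"
proof -
  interpret partial_order "L_interval n" by (rule partial_order_L_interval)
  show ?thesis
    unfolding bottom_def
  proof (rule some_equality)
    show least: "least (L_interval n) id (carrier (L_interval n))"
      using id_least id_in_signed_involutions by (auto simp: least_def carrier_L_interval)
    show "x = id" if "least (L_interval n) x (carrier (L_interval n))" for x
      using that least by (rule least_unique)
  qed
qed

lemma top_L_interval: "\<top>\<^bsub>L_interval n\<^esub> = all_sign_changes n"
proof -
  interpret partial_order "L_interval n" by (rule partial_order_L_interval)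
  show ?thesis
    unfolding top_def
  proof (rule some_equality)
    show greatest: "greatest (L_interval n) (all_sign_changes n) (carrier (L_interval n))"
      using all_sign_changes_greatest all_sign_changes_in_carrier by (auto simp: greatest_def)
    show "x = all_sign_changes n" if "greatest (L_interval n) x (carrier (L_interval n))" for x
      using that greatest by (rule greatest_unique)
  qed
qed

section \<open>The absolute length as rank function\<close>

lemma abs_length_less:
  assumes "u \<in> carrier (L_interval n)" "v \<in> carrier (L_interval n)" "le (L_interval n) u v" "u \<noteq> v"
  shows "abs_length n u < abs_length n v"
proof -
  have h: "u \<in> hyperoctahedral n" "v \<in> hyperoctahedral n"
    using assms signed_involutions_subset by (auto simp: carrier_L_interval)
  have "inv u \<circ> v \<noteq> id"
    using comp_inv_comp[OF h(1), of v] assms by auto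
  then have "abs_length n (inv u \<circ> v) \<noteq> 0"
    using abs_length_eq_0D[of "inv u \<circ> v" n] h
    by (blast intro: hyperoctahedral_comp hyperoctahedral_inv)
  then show ?thesis using assms by (simp add: le_L_interval)
qed

text \<open>Multiplying \<open>u\<close> by the first letter of a reduced word for \<open>u\<^sup>-\<^sup>1 v\<close> yields a cover of \<open>u\<close>.\<close>

lemma L_interval_gap:
  assumes u: "u \<in> carrier (L_interval n)" and v: "v \<in> carrier (L_interval n)"
    and le: "le (L_interval n) u v" and gap: "abs_length n u + 1 < abs_length n v"
  shows "\<exists>z\<in>carrier (L_interval n). le (L_interval n) u z \<and> le (L_interval n) z v \<and> z \<noteq> u \<and> z \<noteq> v"
proof -
  define c where "c = all_sign_changes n"
  have h: "u \<in> hyperoctahedral n" "v \<in> hyperoctahedral n" "c \<in> hyperoctahedral n"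
    using u v signed_involutions_subset all_sign_changes_in by (auto simp: carrier_L_interval c_def)
  have hq: "inv u \<circ> v \<in> hyperoctahedral n"
    using h by (intro hyperoctahedral_comp hyperoctahedral_inv)
  obtain ts where ts: "length ts = abs_length n (inv u \<circ> v)" "set ts \<subseteq> reflections n"
    "composition ts = inv u \<circ> v"
    using ex_reduced_word[OF hq] by blast
  have len: "abs_length n u + length ts = abs_length n v"
    using le ts by (simp add: le_L_interval)
  with gap obtain t ts' where ts': "ts = t # ts'" by (cases ts) auto
  have t: "t \<in> hyperoctahedral n" and hts': "composition ts' \<in> hyperoctahedral n"
    using ts ts' reflections_subset composition_in_hyperoctahedral by auto
  define z where "z = u \<circ> t"
  have z: "z \<in> hyperoctahedral n" using h t by (simp add: z_def hyperoctahedral_comp)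
  have "z \<circ> composition ts' = v"
    using ts ts' comp_inv_comp[OF h(1), of v] by (simp add: z_def comp_assoc)
  then have zv: "inv z \<circ> v = composition ts'"
    using inv_comp_comp[OF z] by blast
  have uz: "inv u \<circ> z = t" unfolding z_def by (rule inv_comp_comp[OF h(1)])
  have vz: "v = z \<circ> (inv z \<circ> v)" by (rule comp_inv_comp[OF z, symmetric])
  have lt: "abs_length n t \<le> 1"
    using abs_length_le[of "[t]" n] ts ts' by simp
  have lts': "abs_length n (composition ts') \<le> length ts'"
    using abs_length_le[of ts' n] ts ts' by simp
  have "abs_length n z \<le> abs_length n u + abs_length n t"
    unfolding z_def by (rule abs_length_comp_le[OF h(1) t])
  moreover have "abs_length n v \<le> abs_length n z + abs_length n (composition ts')"
    using abs_length_comp_le[OF z hts'] vz zv by simp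
  ultimately have lz: "abs_length n z = abs_length n u + 1" "abs_length n t = 1"
    "abs_length n v = abs_length n z + abs_length n (composition ts')"
    using lt lts' len ts' by auto
  \<comment> \<open>A product of an involution and a reflection need not be an involution. Passing
    through \<open>v\<close> shows that \<open>z\<close> lies below \<open>c\<close>, which makes it
    one.\<close>
  have "inv z \<circ> c = (inv z \<circ> v) \<circ> (inv v \<circ> c)"
    using comp_inv_comp[OF h(2), of c] by (simp add: comp_assoc)
  then have "abs_length n (inv z \<circ> c) \<le> abs_length n (inv z \<circ> v) + abs_length n (inv v \<circ> c)"
    using abs_length_comp_le[of "inv z \<circ> v" n "inv v \<circ> c"] h z
    by (simp add: hyperoctahedral_comp hyperoctahedral_inv)
  moreover have "abs_length n v + abs_length n (inv v \<circ> c) = n"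
    using all_sign_changes_greatest[OF v] by (simp add: le_L_interval c_def abs_length_all_sign_changes)
  ultimately have "abs_length n z + abs_length n (inv z \<circ> c) \<le> n"
    using lz zv by simp
  then have "z \<in> signed_involutions n"
    using involution_if_below_all_sign_changes[OF z] hyperoctahedral_odd[OF z]
      hyperoctahedral_outside[OF z] by (simp add: c_def signed_involutions_def)
  moreover have "le (L_interval n) u z" "le (L_interval n) z v"
    using lz uz zv by (auto simp: le_L_interval)
  moreover have "z \<noteq> u" "z \<noteq> v" using lz gap by auto
  ultimately show ?thesis by (auto simp: carrier_L_interval)
qed

section \<open>Multichains as labelled matchings\<close>

interpretation L: finite_poset "L_interval n" for n
proof -
  interpret partial_order "L_interval n" by (rule partial_order_L_interval)
  show "finite_poset (L_interval n)"
    by unfold_locales (simp add: carrier_L_interval finite_signed_involutions)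
qed

text \<open>Along a multichain of length \<open>l\<close>, indexed from \<open>0\<close>, a point \<open>i\<close> that is never paired is
  fixed before some time \<open>s \<le> l\<close> and sign-changed from then on; a point that is paired at some
  time is fixed before time \<open>s\<close>, mapped to one and the same \<open>e * j\<close> (with \<open>e = 1\<close> or \<open>e = -1\<close>)
  before time \<open>t\<close>, and sign-changed from then on. The label of such a pair is \<open>(e, t, s)\<close>.\<close>

definition pair_labels :: "nat \<Rightarrow> (int \<times> nat \<times> nat) set" where
  "pair_labels l = {1, - 1} \<times> (SIGMA t:{..l}. {..<t})"

abbreviation chain_labels :: "nat \<Rightarrow> nat \<Rightarrow> (int \<Rightarrow> nat + int \<times> int \<times> nat \<times> nat) set" where
  "chain_labels n l \<equiv> matchings {1..int n} {..l} (pair_labels l)"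

definition value_at :: "(int \<Rightarrow> nat + int \<times> int \<times> nat \<times> nat) \<Rightarrow> nat \<Rightarrow> int \<Rightarrow> int" where
  "value_at c k i = (case c i of
       Inl s \<Rightarrow> if k < s then i else - i
     | Inr (j, e, t, s) \<Rightarrow> if k < s then i else if k < t then e * j else - i)"

definition decode :: "nat \<Rightarrow> (int \<Rightarrow> nat + int \<times> int \<times> nat \<times> nat) \<Rightarrow> nat \<Rightarrow> int \<Rightarrow> int" where
  "decode n c k i =
     (if i \<in> {1..int n} then value_at c k i
      else if - i \<in> {1..int n} then - value_at c k (- i) else i)"

lemma finite_pair_labels: "finite (pair_labels l)"
  by (auto simp: pair_labels_def)

text \<open>There are two signs, and the times \<open>s < t\<close> form a two-element subset of
  \<open>{..l}\<close>; the factor two cancels the denominator.\<close>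

lemma card_pair_labels: "card (pair_labels l) = Suc l * l"
proof -
  have "card (SIGMA t:{..l}. {..<t}) = (\<Sum>t\<le>l. t)" by simp
  moreover have "2 * (\<Sum>t\<le>l. t) = Suc l * l"
    using gauss_sum[of l, where 'a = nat] by (simp add: atMost_atLeast0 mult.commute)
  ultimately show ?thesis
    by (simp add: pair_labels_def card_cartesian_product)
qed

lemma chain_labels_cases:
  assumes "c \<in> chain_labels n l" "i \<in> {1..int n}"
  obtains (unmatched) s where "c i = Inl s" "s \<le> l"
    | (matched) j e t s where "c i = Inr (j, e, t, s)" "c j = Inr (i, e, t, s)" "j \<in> {1..int n}"
        "j \<noteq> i" "e = 1 \<or> e = - 1" "s < t" "t \<le> l"
proof -
  have "case c i of Inl s \<Rightarrow> s \<in> {..l}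
      | Inr (j, t) \<Rightarrow> j \<in> {1..int n} \<and> j \<noteq> i \<and> t \<in> pair_labels l \<and> c j = Inr (i, t)"
    using assms unfolding matchings_def by (auto split: if_splits)
  then show ?thesis
    by (cases "c i") (auto simp: pair_labels_def intro: that)
qed

lemma decode_in_signed_involutions:
  assumes c: "c \<in> chain_labels n l"
  shows "decode n c k \<in> signed_involutions n"
proof -
  have odd: "decode n c k (- i) = - decode n c k i" for i
    by (auto simp: decode_def)
  have pos: "decode n c k (decode n c k i) = i" if i: "i \<in> {1..int n}" for i
    using c i
  proof (cases rule: chain_labels_cases)
    case (unmatched s)
    then show ?thesis using i by (auto simp: decode_def value_at_def)
  next
    case (matched j e t s)
    have "decode n c k j = (if k < s then j else if k < t then e * i else - j)"
      using matched by (simp add: decode_def value_at_def)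
    moreover have "decode n c k i = (if k < s then i else if k < t then e * j else - i)"
      using matched i by (simp add: decode_def value_at_def)
    ultimately show ?thesis using odd matched(5) by (auto split: if_splits)
  qed
  have "decode n c k (decode n c k i) = i" for i
  proof -
    consider "i \<in> {1..int n}" | "- i \<in> {1..int n}" | "i \<notin> {1..int n}" "- i \<notin> {1..int n}" by blast
    then show ?thesis
    proof cases
      case 2
      then show ?thesis using pos[of "- i"] odd by simp
    qed (use pos in \<open>auto simp: decode_def\<close>)
  qed
  moreover have "decode n c k i = i" if "i \<notin> signed_set n" for i
    using that by (auto simp: decode_def signed_set_def)
  ultimately show ?thesis
    using odd by (simp add: signed_involutions_def)
qed

lemma block_le_if_positive:
  assumes u: "u \<in> signed_involutions n" and v: "v \<in> signed_involutions n"
    and pos: "\<And>i. i \<in> {1..int n} \<Longrightarrow> v i = - i \<or> u i = i \<or> u i = v i"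
  shows "block_le u v"
  unfolding block_le_def
proof
  fix i
  consider "i \<in> {1..int n}" | "- i \<in> {1..int n}" | "i \<notin> signed_set n"
    by (fastforce simp: signed_set_def)
  then show "v i = - i \<or> u i = i \<or> u i = v i"
  proof cases
    case 2
    then show ?thesis
      using pos[of "- i"] involution_odd[OF u, of i] involution_odd[OF v, of i] by auto
  qed (use pos involution_outside[OF u] in auto)
qed

lemma decode_mono:
  assumes c: "c \<in> chain_labels n l" and "k \<le> k'"
  shows "block_le (decode n c k) (decode n c k')"
proof (rule block_le_if_positive)
  show "decode n c k' i = - i \<or> decode n c k i = i \<or> decode n c k i = decode n c k' i"
    if i: "i \<in> {1..int n}" for i
    using c i
  proof (cases rule: chain_labels_cases)
    case (unmatched s)
    then show ?thesis using i \<open>k \<le> k'\<close> by (auto simp: decode_def value_at_def)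
  next
    case (matched j e t s)
    then show ?thesis using i \<open>k \<le> k'\<close> by (auto simp: decode_def value_at_def)
  qed
qed (rule decode_in_signed_involutions[OF c])+

section \<open>Recovering the labels from a multichain\<close>

text \<open>Times run below \<open>l\<close> while thresholds run up to \<open>l\<close>; the
  threshold \<open>l\<close> records a change that does not occur within the chain.\<close>

lemma threshold_unique:
  "\<lbrakk>s \<le> l; s' \<le> l; \<And>k. k < l \<Longrightarrow> k < s \<longleftrightarrow> k < s'\<rbrakk> \<Longrightarrow> s = (s' :: nat)"
  by (metis linorder_neqE_nat less_le_trans less_irrefl)

lemma threshold_ex:
  assumes "\<And>k k'. \<lbrakk>k \<le> k'; k' < l; P k'\<rbrakk> \<Longrightarrow> P k"
  shows "\<exists>s\<le>l. \<forall>k<l. P k \<longleftrightarrow> k < (s :: nat)"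
proof (cases "\<forall>k<l. P k")
  case False
  define s where "s = (LEAST k. k < l \<and> \<not> P k)"
  have s: "s < l \<and> \<not> P s"
    unfolding s_def using False by - (rule LeastI_ex, blast)
  moreover have "P k" if "k < s" for k
    using not_less_Least[of k "\<lambda>k. k < l \<and> \<not> P k"] that s by (auto simp: s_def)
  moreover have "\<not> P k" if "s \<le> k" "k < l" for k
    using assms that s by blast
  ultimately show ?thesis by (intro exI[of _ s]) (meson less_imp_le not_le)
qed (auto intro: exI[of _ l])

text \<open>The values at a point reveal when it stops being fixed and when it is negated. A matched
  point is visibly paired at time \<open>s\<close>, because \<open>s < t\<close> and
  \<open>t\<close> is at most \<open>l\<close>; there \<open>e * j\<close> determines both
  \<open>e\<close> and \<open>j\<close>, since \<open>j\<close> is positive.\<close>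

lemma decode_inj:
  assumes c: "c \<in> chain_labels n l" and d: "d \<in> chain_labels n l"
    and eq: "\<And>k. k < l \<Longrightarrow> decode n c k = decode n d k"
  shows "c = d"
proof
  fix i
  show "c i = d i"
  proof (cases "i \<in> {1..int n}")
    case False
    then show ?thesis using matchings_outside[OF c] matchings_outside[OF d] by simp
  next
    case i: True
    have val: "value_at c k i = value_at d k i" if "k < l" for k
      using fun_cong[OF eq[OF that], of i] i by (simp add: decode_def)
    have i': "i \<noteq> - i" using i by simp
    from c i show ?thesis
    proof (cases rule: chain_labels_cases)
      case c: (unmatched s)
      from d i show ?thesis
      proof (cases rule: chain_labels_cases)
        case d: (unmatched s')
        have "s = s'"
        proof (rule threshold_unique[OF c(2) d(2)])
          show "k < s \<longleftrightarrow> k < s'" if "k < l" for k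
            using val[OF that] c(1) d(1) i' by (auto simp: value_at_def split: if_splits)
        qed
        then show ?thesis using c d by simp
      next
        \<comment> \<open>At time \<open>s'\<close> the point is paired under \<open>d\<close>,
          whereas an unmatched point only takes the values \<open>i\<close> and
          \<open>- i\<close>.\<close>
        case d: (matched j e t s')
        then show ?thesis
          using val[of s'] c(1) i by (auto simp: value_at_def split: if_splits)
      qed
    next
      case c: (matched j e t s)
      from d i show ?thesis
      proof (cases rule: chain_labels_cases)
        case d: (unmatched s')
        then show ?thesis
          using val[of s] c i by (auto simp: value_at_def split: if_splits)
      next
        case d: (matched j' e' t' s')
        have ne: "e * j \<noteq> i" "e * j \<noteq> - i" "e' * j' \<noteq> i" "e' * j' \<noteq> - i"
          using c d i by auto
        have val': "(if k < s then i else if k < t then e * j else - i)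
            = (if k < s' then i else if k < t' then e' * j' else - i)" if "k < l" for k
          using val[OF that] c(1) d(1) by (simp add: value_at_def)
        have "s = s'"
        proof (rule threshold_unique)
          show "k < s \<longleftrightarrow> k < s'" if "k < l" for k
            using val'[OF that] ne i' by (auto split: if_splits)
        qed (use c d in auto)
        moreover have "t = t'"
        proof (rule threshold_unique)
          show "k < t \<longleftrightarrow> k < t'" if "k < l" for k
            using val'[OF that] ne i' c(6) d(6) by (auto split: if_splits)
        qed (use c d in auto)
        moreover have "e * j = e' * j'"
          using val'[of s] c d calculation by simp
        then have "e = e' \<and> j = j'" using c d by auto
        ultimately show ?thesis using c(1) d(1) by simp
      qed
    qed
  qed
qed

lemma block_leD: "block_le u v \<Longrightarrow> v i = - i \<or> u i = i \<or> u i = v i"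
  by (simp add: block_le_def)

text \<open>Comparability leaves two alternatives at \<open>i\<close> and the same two at its
  partner, and an involution \<open>x\<close> that agrees with \<open>a\<close> at one of them
  agrees at the other. Thus both points of a pair change state at the same times, as a common label
  demands.\<close>

lemma paired_points_synchronized:
  assumes a: "a \<in> signed_involutions n" and x: "x \<in> signed_involutions n"
    and le: "block_le a x \<or> block_le x a" and ne: "a i \<noteq> i" "a i \<noteq> - i"
  shows "x i = i \<longleftrightarrow> x (a i) = a i" "x i = - i \<longleftrightarrow> x (a i) = - a i"
    and "x i = i \<or> x i = - i \<or> x i = a i"
proof -
  define y where "y = a i"
  have ay: "a y = i" by (simp add: y_def involution_involution[OF a])
  have y: "y \<noteq> i" "y \<noteq> - i" using ne by (auto simp: y_def)
  have nz: "i \<noteq> 0" "y \<noteq> 0"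
    using involution_outside[OF a, of 0] ne y ay by (auto simp: signed_set_def y_def)
  have "(x i = i \<longleftrightarrow> x y = y) \<and> (x i = - i \<longleftrightarrow> x y = - y) \<and> (x i = i \<or> x i = - i \<or> x i = y)"
  proof -
    have xy: "x i = y \<longleftrightarrow> x y = i"
      using involution_involution[OF x] by metis
    from le show ?thesis
    proof
      assume "block_le a x"
      from block_leD[OF this, of i] block_leD[OF this, of y]
      have "x i = - i \<or> x i = y" "x y = - y \<or> x y = i"
        using y ay by (auto simp: y_def[symmetric])
      then show ?thesis using xy y nz by auto
    next
      assume "block_le x a"
      from block_leD[OF this, of i] block_leD[OF this, of y]
      have "x i = i \<or> x i = y" "x y = y \<or> x y = i"
        using y ay by (auto simp: y_def[symmetric])
      then show ?thesis using xy y nz by auto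
    qed
  qed
  then show "x i = i \<longleftrightarrow> x (a i) = a i" "x i = - i \<longleftrightarrow> x (a i) = - a i"
    and "x i = i \<or> x i = - i \<or> x i = a i"
    unfolding y_def by blast+
qed

text \<open>Fixed times form an initial segment and negated times a final one, so each point has two
  thresholds. A point with distinct thresholds is paired in between, with the constant partner found
  at time \<open>s i\<close>.\<close>

lemma decode_surj:
  assumes X: "\<And>k. k < l \<Longrightarrow> X k \<in> signed_involutions n"
    and mono: "\<And>k k'. \<lbrakk>k \<le> k'; k' < l\<rbrakk> \<Longrightarrow> block_le (X k) (X k')"
  shows "\<exists>c\<in>chain_labels n l. \<forall>k<l. decode n c k = X k"
proof -
  have "\<exists>s\<le>l. \<forall>k<l. X k i = i \<longleftrightarrow> k < s" for i
  proof (rule threshold_ex)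
    fix k k' assume k: "k \<le> k'" "k' < l" "X k' i = i"
    have "X k 0 = 0" using involution_outside[OF X, of k 0] k by (simp add: signed_set_def)
    then show "X k i = i" using mono[OF k(1,2)] k(3) unfolding block_le_def by (cases "i = 0") force+
  qed
  then obtain s where s: "\<And>i. s i \<le> l" "\<And>i k. k < l \<Longrightarrow> X k i = i \<longleftrightarrow> k < s i"
    by metis
  have "\<exists>t\<le>l. \<forall>k<l. X k i \<noteq> - i \<longleftrightarrow> k < t" for i
  proof (rule threshold_ex)
    fix k k' assume k: "k \<le> k'" "k' < l" "X k' i \<noteq> - i"
    have "X k' 0 = 0" using involution_outside[OF X, of k' 0] k by (simp add: signed_set_def)
    then show "X k i \<noteq> - i" using mono[OF k(1,2)] k(3) unfolding block_le_def by (cases "i = 0") force+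
  qed
  then obtain t where t: "\<And>i. t i \<le> l" "\<And>i k. k < l \<Longrightarrow> X k i \<noteq> - i \<longleftrightarrow> k < t i"
    by metis
  \<comment> \<open>Otherwise the nonzero point \<open>i\<close> would be fixed and negated at time
    \<open>t i\<close>.\<close>
  have st: "s i \<le> t i" if "i \<in> {1..int n}" for i
  proof (rule ccontr)
    assume "\<not> ?thesis"
    then have "t i < s i" "t i < l" using s(1)[of i] by auto
    then show False using s(2)[of "t i" i] t(2)[of "t i" i] that by auto
  qed
  \<comment> \<open>Equal thresholds mean that the point is never seen paired. Otherwise absolute
    value and sign split the image at time \<open>s i\<close> into the partner and the factor
    \<open>e\<close>.\<close>
  define c where "c i = (if i \<in> {1..int n}
      then if s i = t i then Inl (s i)
        else Inr (\<bar>X (s i) i\<bar>, sgn (X (s i) i), t i, s i)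
      else undefined)" for i
  have pair: "\<bar>y\<bar> \<in> {1..int n}" "\<bar>y\<bar> \<noteq> i" "s \<bar>y\<bar> = s i" "t \<bar>y\<bar> = t i" "X (s i) \<bar>y\<bar> = sgn y * i"
      "\<And>k. \<lbrakk>s i \<le> k; k < t i\<rbrakk> \<Longrightarrow> X k i = y" "sgn y = 1 \<or> sgn y = - 1"
    if i: "i \<in> {1..int n}" and neq: "s i \<noteq> t i" and y: "y = X (s i) i" for i y
  proof -
    have lt: "s i < t i" using st[OF i] neq by simp
    then have sl: "s i < l" using t(1)[of i] by simp
    note a = X[OF sl]
    have ne: "y \<noteq> i" "y \<noteq> - i"
      using s(2)[OF sl, of i] t(2)[OF sl, of i] lt y by auto
    have "i \<in> signed_set n" using i by (auto simp: signed_set_def)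
    from involution_in_signed_set[OF a this] show yn: "\<bar>y\<bar> \<in> {1..int n}"
      by (auto simp: y signed_set_def)
    show "\<bar>y\<bar> \<noteq> i" using ne by (auto simp: abs_if split: if_splits)
    have cmp: "block_le (X (s i)) (X k) \<or> block_le (X k) (X (s i))" if "k < l" for k
      using mono[of "s i" k] mono[of k "s i"] that sl by linarith
    note sync = paired_points_synchronized[OF a X cmp, of _ i, folded y, OF _ _ ne]
    have abs_iff: "x \<bar>y\<bar> = \<bar>y\<bar> \<longleftrightarrow> x y = y" "x \<bar>y\<bar> = - \<bar>y\<bar> \<longleftrightarrow> x y = - y"
      if "x \<in> signed_involutions n" for x
      using involution_odd[OF that, of y] by (auto simp: abs_if)
    show "s \<bar>y\<bar> = s i"
    proof (rule threshold_unique[of _ l])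
      show "k < s \<bar>y\<bar> \<longleftrightarrow> k < s i" if "k < l" for k
        using sync(1)[OF that that] s(2)[OF that] abs_iff(1)[OF X[OF that]] by metis
    qed (rule s)+
    show "t \<bar>y\<bar> = t i"
    proof (rule threshold_unique[of _ l])
      show "k < t \<bar>y\<bar> \<longleftrightarrow> k < t i" if "k < l" for k
        using sync(2)[OF that that] t(2)[OF that] abs_iff(2)[OF X[OF that]] by metis
    qed (rule t)+
    show "X (s i) \<bar>y\<bar> = sgn y * i"
      using involution_involution[OF a, of i] involution_odd[OF a, of y] yn
      by (auto simp: y[symmetric] abs_if sgn_if)
    show "X k i = y" if "s i \<le> k" "k < t i" for k
    proof -
      have "k < l" using that t(1)[of i] by simp
      then show ?thesis
        using sync(3)[of k] s(2)[of k i] t(2)[of k i] that by auto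
    qed
    show "sgn y = 1 \<or> sgn y = - 1" using yn by (auto simp: sgn_if)
  qed
  have "c \<in> chain_labels n l"
    unfolding matchings_def
  proof (intro CollectI allI)
    fix i
    show "if i \<in> {1..int n} then (case c i of Inl s \<Rightarrow> s \<in> {..l}
        | Inr (j, r) \<Rightarrow> j \<in> {1..int n} \<and> j \<noteq> i \<and> r \<in> pair_labels l \<and> c j = Inr (i, r))
      else c i = undefined"
    proof (cases "i \<in> {1..int n}")
      case False
      then have "c i = undefined" by (simp only: c_def if_False)
      then show ?thesis using False by (simp only: if_False)
    next
      case i: True
      show ?thesis
      proof (cases "s i = t i")
        case True
        then show ?thesis using i s(1)[of i] by (simp add: c_def)
      next
        case False
        define y where "y = X (s i) i"
        note p = pair[OF i False y_def]
        have ci: "c i = Inr (\<bar>y\<bar>, sgn y, t i, s i)"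
          using i False by (simp add: c_def y_def)
        have "(sgn y, t i, s i) \<in> pair_labels l"
          using p(7) False st[OF i] t(1)[of i] by (auto simp: pair_labels_def)
        \<comment> \<open>At the partner the image of the same time is \<open>sgn y * i\<close>, so
          it yields the partner \<open>i\<close> and the same sign.\<close>
        moreover have "c \<bar>y\<bar> = Inr (i, sgn y, t i, s i)"
        proof -
          have "\<bar>sgn y * i\<bar> = i" "sgn (sgn y * i) = sgn y"
            using p(7) i by (auto simp: sgn_mult)
          then show ?thesis
            using p(1,3,4,5) False by (simp add: c_def)
        qed
        ultimately show ?thesis
          using i ci p(1,2) by simp
      qed
    qed
  qed
  moreover have "decode n c k = X k" if k: "k < l" for k
  proof -
    have pos: "value_at c k i = X k i" if i: "i \<in> {1..int n}" for i
    proof (cases "s i = t i")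
      case True
      then show ?thesis
        using i s(2)[OF k, of i] t(2)[OF k, of i] by (auto simp: c_def value_at_def)
    next
      case False
      have "sgn (X (s i) i) * \<bar>X (s i) i\<bar> = X (s i) i" by (simp add: sgn_mult_abs)
      then show ?thesis
        using i False s(2)[OF k, of i] t(2)[OF k, of i] pair(6)[OF i False refl, of k]
        by (auto simp: c_def value_at_def not_less)
    qed
    have "decode n c k i = X k i" for i
    proof -
      consider "i \<in> {1..int n}" | "- i \<in> {1..int n}" | "i \<notin> signed_set n"
        by (fastforce simp: signed_set_def)
      then show ?thesis
      proof cases
        case 1
        then show ?thesis using pos by (simp add: decode_def)
      next
        case 2
        then show ?thesis using pos[of "- i"] involution_odd[OF X[OF k], of i]
          by (simp add: decode_def)
      next
        case 3
        then show ?thesis using involution_outside[OF X[OF k]]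
          by (auto simp: decode_def signed_set_def)
      qed
    qed
    then show ?thesis by (rule ext)
  qed
  ultimately show ?thesis by blast
qed

lemma bij_betw_chain_labels:
  "bij_betw (\<lambda>c. map (decode n c) [0..<l]) (chain_labels n l) (multichains (L_interval n) l)"
  unfolding bij_betw_def
proof (intro conjI equalityI subsetI)
  show "inj_on (\<lambda>c. map (decode n c) [0..<l]) (chain_labels n l)"
    by (rule inj_onI, erule decode_inj) auto
next
  fix xs assume "xs \<in> (\<lambda>c. map (decode n c) [0..<l]) ` chain_labels n l"
  then obtain c where c: "c \<in> chain_labels n l" and xs: "xs = map (decode n c) [0..<l]" by blast
  show "xs \<in> multichains (L_interval n) l"
    unfolding L.multichains_eq_sorted xs
    using decode_in_signed_involutions[OF c] decode_mono[OF c]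
    by (auto simp: carrier_L_interval le_L_interval_iff_block_le sorted_wrt_iff_nth_less)
next
  fix xs assume "xs \<in> multichains (L_interval n) l"
  then have len: "length xs = l" and sub: "set xs \<subseteq> signed_involutions n"
    and sorted: "sorted_wrt (le (L_interval n)) xs"
    by (auto simp: L.multichains_eq_sorted carrier_L_interval)
  have X: "xs ! k \<in> signed_involutions n" if "k < l" for k
    using that len sub by (auto simp: subset_iff)
  have "block_le (xs ! k) (xs ! k')" if "k \<le> k'" "k' < l" for k k'
  proof (cases "k = k'")
    case True
    then show ?thesis by (simp add: block_le_def)
  next
    case False
    then have "le (L_interval n) (xs ! k) (xs ! k')"
      using that len sorted by (simp add: sorted_wrt_iff_nth_less)
    then show ?thesis
      using le_L_interval_iff_block_le[OF X X, of k k'] that by simp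
  qed
  from decode_surj[of l "(!) xs", OF X this] obtain c where c: "c \<in> chain_labels n l" "\<forall>k<l. decode n c k = xs ! k"
    by blast
  then have "xs = map (decode n c) [0..<l]"
    using len by (intro nth_equalityI) auto
  then show "xs \<in> (\<lambda>c. map (decode n c) [0..<l]) ` chain_labels n l"
    using c by blast
qed

lemma card_multichains_L_interval:
  "card (multichains (L_interval n) l) = hermite_sum n (Suc l) (Suc l * l)"
proof -
  have "card (multichains (L_interval n) l) = card (chain_labels n l)"
    using bij_betw_same_card[OF bij_betw_chain_labels] by metis
  then show ?thesis
    by (simp add: card_matchings finite_pair_labels card_pair_labels)
qed

text \<open>Multichains of length one are the elements themselves, so the case \<open>l = 1\<close>
  parametrizes the interval.\<close>

lemma bij_betw_decode:
  "bij_betw (\<lambda>c. decode n c 0) (chain_labels n 1) (carrier (L_interval n))"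
proof -
  have "bij_betw hd (multichains (L_interval n) 1) (carrier (L_interval n))"
    by (rule bij_betw_byWitness[of _ "\<lambda>w. [w]"])
      (auto simp: multichains_def length_Suc_conv)
  from bij_betw_trans[OF bij_betw_chain_labels this] show ?thesis
    by (simp add: comp_def)
qed

lemma card_L_interval: "card (carrier (L_interval n)) = hermite_sum n 2 2"
  using bij_betw_same_card[OF bij_betw_decode[of n]]
  by (simp add: card_matchings finite_pair_labels card_pair_labels numeral_2_eq_2)

section \<open>The enumerative invariants\<close>

lemma odd_double_fact_mult: "odd_double_fact k * 2 ^ k * fact k = fact (2 * k)"
proof (induction k)
  case 0
  then show ?case by (simp add: odd_double_fact_0)
next
  case (Suc k)
  have "odd_double_fact (Suc k) * 2 ^ Suc k * fact (Suc k)
      = (2 * k + 1) * (2 * Suc k) * (odd_double_fact k * 2 ^ k * fact k)"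
    unfolding odd_double_fact_Suc power_Suc fact_Suc of_nat_id by (simp only: ac_simps)
  also have "\<dots> = (2 * k + 1) * (2 * Suc k) * fact (2 * k)" unfolding Suc.IH ..
  also have "\<dots> = fact (2 * Suc k)" by (simp add: algebra_simps)
  finally show ?case .
qed

lemma card_carrier_formula:
  "card (carrier (L_interval n)) =
     (\<Sum>k=0..n div 2. (n choose (2 * k)) * 2 ^ (n - k) * odd_double_fact k)"
  unfolding card_L_interval hermite_sum_def
proof (rule sum.cong)
  fix k assume "k \<in> {0..n div 2}"
  then have "n - k = (n - 2 * k) + k" by auto
  then have "(2 :: nat) ^ (n - k) = 2 ^ (n - 2 * k) * 2 ^ k" by (simp only: power_add)
  then show "of_nat ((n choose (2 * k)) * odd_double_fact k) * 2 ^ (n - 2 * k) * 2 ^ k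
      = (n choose (2 * k)) * 2 ^ (n - k) * odd_double_fact k"
    by simp
qed simp

section \<open>Rank sizes\<close>

text \<open>For \<open>l = 1\<close> an unmatched point has threshold 0 if it is negated and 1 if it
  is fixed, and a matched point has weight 1. The exponent is twice the length because weights
  are.\<close>

lemma decode_weight:
  assumes c: "c \<in> chain_labels n 1"
  shows "weight (\<lambda>s. monom 1 (if s = 0 then 2 else 0)) (\<lambda>_. monom 1 1) {1..int n} c
    = (monom 1 (2 * abs_length n (decode n c 0)) :: nat poly)"
proof -
  have "label_weight (\<lambda>s. monom 1 (if s = 0 then 2 else 0)) (\<lambda>_. monom 1 1) (c i)
      = (monom 1 (point_weight (decode n c 0) i) :: nat poly)" if i: "i \<in> {1..int n}" for i
    using c i
  proof (cases rule: chain_labels_cases)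
    case (unmatched s)
    then show ?thesis
      using i by (auto simp: label_weight_def point_weight_def decode_def value_at_def)
  next
    case (matched j e t s)
    then have "s = 0" "t = 1" "e * j \<noteq> i" "e * j \<noteq> - i" using i by auto
    then show ?thesis
      using i matched(1) by (auto simp: label_weight_def point_weight_def decode_def value_at_def)
  qed
  then have "weight (\<lambda>s. monom 1 (if s = 0 then 2 else 0)) (\<lambda>_. monom 1 1) {1..int n} c
      = (\<Prod>i\<in>{1..int n}. monom 1 (point_weight (decode n c 0) i) :: nat poly)"
    unfolding weight_def by (intro prod.cong) auto
  also have "\<dots> = monom 1 (\<Sum>i\<in>{1..int n}. point_weight (decode n c 0) i)"
    by (induction rule: infinite_finite_induct) (simp_all add: mult_monom monom_eq_1 del: One_nat_def)
  also have "(\<Sum>i\<in>{1..int n}. point_weight (decode n c 0) i) = 2 * abs_length n (decode n c 0)"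
    using abs_length_involution_and_negate(1)[OF decode_in_signed_involutions[OF c]] by simp
  finally show ?thesis .
qed

text \<open>The square \<open>q\<close> of the variable marks the rank: an unmatched point
  contributes \<open>1 + q\<close>, and a pair contributes \<open>2 * q\<close>, one
  \<open>q\<close> for each sign.\<close>

lemma rank_generating_poly:
  "(\<Sum>w\<in>carrier (L_interval n). monom 1 (2 * abs_length n w) :: nat poly)
    = hermite_sum n (1 + monom 1 2) (monom 2 2)"
proof -
  let ?f = "\<lambda>s::nat. monom 1 (if s = 0 then 2 else 0) :: nat poly" and ?g = "\<lambda>_. monom 1 1 :: nat poly"
  have "(\<Sum>w\<in>carrier (L_interval n). monom 1 (2 * abs_length n w) :: nat poly)
      = (\<Sum>c\<in>chain_labels n 1. monom 1 (2 * abs_length n (decode n c 0)))"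
    by (rule sum.reindex_bij_betw[OF bij_betw_decode, symmetric])
  also have "\<dots> = (\<Sum>c\<in>chain_labels n 1. weight ?f ?g {1..int n} c)"
    using decode_weight by (intro sum.cong) auto
  also have "\<dots> = hermite_sum (card {1..int n}) (sum ?f {..1}) (\<Sum>t\<in>pair_labels 1. ?g t ^ 2)"
    by (intro sum_weight_matchings) (auto simp: finite_pair_labels)
  also have "sum ?f {..1} = 1 + monom 1 2"
    by (simp add: numeral_2_eq_2 one_pCons monom_0 add.commute)
  also have "(\<Sum>t\<in>pair_labels 1. ?g t ^ 2) = monom 2 2"
    by (simp add: card_pair_labels monom_power numeral_poly smult_monom)
  finally show ?thesis by simp
qed

lemma coeff_hermite_term:
  "coeff ((1 + monom 1 2 :: nat poly) ^ m * monom 2 2 ^ k) (2 * r)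
    = (if k \<le> r then 2 ^ k * (m choose (r - k)) else 0)"
proof -
  have "(1 + monom 1 2 :: nat poly) ^ m = (monom 1 2 + 1) ^ m" by (simp add: add.commute)
  also have "\<dots> = (\<Sum>j\<le>m. monom (m choose j) (2 * j))"
    by (simp add: binomial_ring monom_power mult.commute of_nat_poly smult_monom)
  finally have "(1 + monom 1 2 :: nat poly) ^ m * monom 2 2 ^ k
      = (\<Sum>j\<le>m. monom (m choose j) (2 * j) * monom (2 ^ k) (2 * k))"
    by (simp only: sum_distrib_right monom_power)
  also have "\<dots> = (\<Sum>j\<le>m. monom (2 ^ k * (m choose j)) (2 * (j + k)))"
    by (intro sum.cong refl) (simp add: mult_monom mult.commute distrib_left)
  finally have "(1 + monom 1 2 :: nat poly) ^ m * monom 2 2 ^ k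
      = (\<Sum>j\<le>m. monom (2 ^ k * (m choose j)) (2 * (j + k)))" .
  then have "coeff ((1 + monom 1 2 :: nat poly) ^ m * monom 2 2 ^ k) (2 * r)
      = (\<Sum>j\<le>m. if j + k = r then 2 ^ k * (m choose j) else 0)"
    by (simp add: coeff_sum del: distrib_left_numeral)
  also have "\<dots> = (if k \<le> r then 2 ^ k * (m choose (r - k)) else 0)"
  proof (cases "k \<le> r")
    case True
    then have "(\<Sum>j\<le>m. if j + k = r then 2 ^ k * (m choose j) else 0)
        = (\<Sum>j\<le>m. if j = r - k then 2 ^ k * (m choose j) else 0)"
      by (intro sum.cong) auto
    then show ?thesis using True by (auto simp: binomial_eq_0)
  qed (auto intro: sum.neutral)
  finally show ?thesis .
qed

lemma card_rank:
  "card {w \<in> carrier (L_interval n). abs_length n w = r} =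
     (\<Sum>k=0..n div 2. (n choose (2 * k)) * odd_double_fact k *
        (if k \<le> r then 2 ^ k * ((n - 2 * k) choose (r - k)) else 0))"
proof -
  have "card {w \<in> carrier (L_interval n). abs_length n w = r}
      = (\<Sum>w\<in>carrier (L_interval n). if abs_length n w = r then 1 else 0)"
    unfolding carrier_L_interval card_eq_sum
    by (rule sum.inter_filter) (rule finite_signed_involutions)
  also have "\<dots> = coeff (\<Sum>w\<in>carrier (L_interval n). monom 1 (2 * abs_length n w) :: nat poly) (2 * r)"
    by (simp add: coeff_sum del: One_nat_def)
  also have "\<dots> = coeff (hermite_sum n (1 + monom 1 2) (monom 2 2) :: nat poly) (2 * r)"
    by (simp only: rank_generating_poly)
  also have "\<dots> = (\<Sum>k=0..n div 2. coeff (of_nat ((n choose (2 * k)) * odd_double_fact k)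
      * ((1 + monom 1 2 :: nat poly) ^ (n - 2 * k) * monom 2 2 ^ k)) (2 * r))"
    by (simp only: hermite_sum_def coeff_sum mult.assoc)
  also have "\<dots> = (\<Sum>k=0..n div 2. (n choose (2 * k)) * odd_double_fact k *
        coeff ((1 + monom 1 2 :: nat poly) ^ (n - 2 * k) * monom 2 2 ^ k) (2 * r))"
    by (simp only: of_nat_poly mult_pCons_left coeff_smult) (simp add: mult.assoc)
  finally show ?thesis by (simp only: coeff_hermite_term)
qed

text \<open>Since \<open>odd_double_fact k * 2 ^ k\<close> equals
  \<open>fact (2 * k) / fact k\<close>, the factorials of \<open>2 * k\<close> and
  \<open>n - 2 * k\<close> cancel.\<close>

lemma rank_summand:
  assumes "k \<le> r" "r \<le> n" "k \<le> n - r"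
  shows "real ((n choose (2 * k)) * odd_double_fact k * (2 ^ k * ((n - 2 * k) choose (r - k))))
    = fact n / (fact k * fact (r - k) * fact (n - r - k))"
proof -
  have le: "2 * k \<le> n" "r - k \<le> n - 2 * k" using assms by auto
  have sub: "n - 2 * k - (r - k) = n - r - k" using assms by auto
  have "real (odd_double_fact k) * 2 ^ k * fact k = fact (2 * k)"
    using arg_cong[OF odd_double_fact_mult[of k], of real] by (simp del: fact_Suc)
  then have d: "real (odd_double_fact k) * 2 ^ k = fact (2 * k) / fact k"
    by (simp add: field_simps)
  have "real ((n choose (2 * k)) * odd_double_fact k * (2 ^ k * ((n - 2 * k) choose (r - k))))
      = real (n choose (2 * k)) * (real (odd_double_fact k) * 2 ^ k) * real ((n - 2 * k) choose (r - k))"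
    by simp
  also have "\<dots> = fact n / (fact (2 * k) * fact (n - 2 * k)) * (fact (2 * k) / fact k)
      * (fact (n - 2 * k) / (fact (r - k) * fact (n - r - k)))"
    by (simp only: d binomial_fact[OF le(1)] binomial_fact[OF le(2)] sub)
  also have "\<dots> = fact n / (fact k * fact (r - k) * fact (n - r - k))"
    by simp
  finally show ?thesis .
qed

lemma card_rank_formula:
  assumes "r \<le> n"
  shows "real (card {w \<in> carrier (L_interval n). abs_length n w = r}) =
    (\<Sum>k=0..min r (n - r). fact n / (fact k * fact (r - k) * fact (n - r - k)))"
proof -
  let ?h = "\<lambda>k. real ((n choose (2 * k)) * odd_double_fact k *
        (if k \<le> r then 2 ^ k * ((n - 2 * k) choose (r - k)) else 0))"
  have "real (card {w \<in> carrier (L_interval n). abs_length n w = r}) = (\<Sum>k=0..n div 2. ?h k)"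
    unfolding card_rank of_nat_sum ..
  \<comment> \<open>Of the summands dropped here, those with \<open>k > r\<close> vanish by the
    \<open>if\<close>, and those with \<open>k > n - r\<close> because then
    \<open>n - 2 * k < r - k\<close>.\<close>
  also have "\<dots> = (\<Sum>k=0..min r (n - r). ?h k)"
  proof (rule sum.mono_neutral_right)
    show "\<forall>k\<in>{0..n div 2} - {0..min r (n - r)}. ?h k = 0"
    proof
      fix k assume "k \<in> {0..n div 2} - {0..min r (n - r)}"
      then have "k \<le> r \<Longrightarrow> n - 2 * k < r - k" using assms by (auto simp: min_def split: if_splits)
      then show "?h k = 0" by (simp add: binomial_eq_0)
    qed
  qed (use assms in auto)
  also have "\<dots> = (\<Sum>k=0..min r (n - r). fact n / (fact k * fact (r - k) * fact (n - r - k)))"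
  proof (rule sum.cong)
    fix k assume "k \<in> {0..min r (n - r)}"
    then show "?h k = fact n / (fact k * fact (r - k) * fact (n - r - k))"
      using rank_summand[of k r n] assms by simp
  qed simp
  finally show ?thesis .
qed

section \<open>Zeta polynomial, maximal chains and Moebius function of the interval\<close>

definition zeta_formula :: "nat \<Rightarrow> real poly" where
  "zeta_formula n = (\<Sum>k=0..n div 2.
     smult (real ((n choose (2 * k)) * odd_double_fact k)) ([:0, 1:] ^ (n - k) * [:- 1, 1:] ^ k))"

lemma poly_zeta_formula:
  "poly (zeta_formula n) m =
     (\<Sum>k=0..n div 2. real (n choose (2 * k)) * m ^ (n - k) * (m - 1) ^ k * real (odd_double_fact k))"
  by (simp add: zeta_formula_def poly_sum algebra_simps)

lemma zeta_polynomial_L_interval: "zeta_polynomial (L_interval n) = zeta_formula n"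
proof (rule L.zeta_polynomial_unique)
  fix m :: nat assume "m \<ge> 2"
  then have "real (card (multichains (L_interval n) (m - 1))) = real (hermite_sum n m (m * (m - 1)))"
    by (simp add: card_multichains_L_interval)
  also have "\<dots> = (\<Sum>k=0..n div 2. real (n choose (2 * k)) * real m ^ (n - k) * (real m - 1) ^ k
      * real (odd_double_fact k))"
    unfolding hermite_sum_def of_nat_sum
  proof (rule sum.cong)
    fix k assume "k \<in> {0..n div 2}"
    then have "n - k = (n - 2 * k) + k" by auto
    then have "real m ^ (n - k) = real m ^ (n - 2 * k) * real m ^ k" by (simp only: power_add)
    then show "real (of_nat ((n choose (2 * k)) * odd_double_fact k) * m ^ (n - 2 * k) * (m * (m - 1)) ^ k)
        = real (n choose (2 * k)) * real m ^ (n - k) * (real m - 1) ^ k * real (odd_double_fact k)"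
      using \<open>m \<ge> 2\<close> by (simp add: power_mult_distrib of_nat_diff)
  qed simp
  finally show "poly (zeta_formula n) (real m) = real (card (multichains (L_interval n) (m - 1)))"
    by (simp add: poly_zeta_formula)
qed

text \<open>Each product of linear factors is monic of degree \<open>n\<close>, whatever
  \<open>k\<close> is.\<close>

lemma coeff_zeta_formula:
  "coeff (zeta_formula n) n = (\<Sum>k=0..n div 2. real ((n choose (2 * k)) * odd_double_fact k))"
  unfolding zeta_formula_def coeff_sum
proof (rule sum.cong)
  fix k assume k: "k \<in> {0..n div 2}"
  let ?q = "[:0, 1:] ^ (n - k) * [:- 1, 1:] ^ k :: real poly"
  have "degree ?q = n"
    using k by (simp add: degree_mult_eq degree_power_eq)
  moreover have "lead_coeff ?q = 1"
    by (simp add: lead_coeff_mult lead_coeff_power)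
  ultimately show "coeff (smult (real ((n choose (2 * k)) * odd_double_fact k)) ?q) n
      = real ((n choose (2 * k)) * odd_double_fact k)"
    by simp
qed simp

lemma card_maximal_chains_formula:
  "card (maximal_chains (L_interval n)) =
     fact n * (\<Sum>k=0..n div 2. (n choose (2 * k)) * odd_double_fact k)"
proof -
  have bot: "\<exists>b\<in>carrier (L_interval n). abs_length n b = 0 \<and>
      (\<forall>y\<in>carrier (L_interval n). le (L_interval n) b y)"
    by (intro bexI[of _ id] conjI ballI id_least)
      (auto simp: abs_length_id carrier_L_interval id_in_signed_involutions)
  have "real (card (maximal_chains (L_interval n))) = fact n * coeff (zeta_formula n) n"
    using L.card_maximal_chains[OF all_sign_changes_in_carrier all_sign_changes_greatest
        abs_length_less L_interval_gap bot]
    by (simp add: abs_length_all_sign_changes zeta_polynomial_L_interval)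
  also have "\<dots> = real (fact n * (\<Sum>k=0..n div 2. (n choose (2 * k)) * odd_double_fact k))"
    by (simp add: coeff_zeta_formula)
  finally show ?thesis by (simp only: of_nat_eq_iff)
qed

lemma mobius_formula:
  "mobius (L_interval n) \<bottom>\<^bsub>L_interval n\<^esub> \<top>\<^bsub>L_interval n\<^esub> =
     (- 1) ^ n * (\<Sum>k=0..n div 2. int (n choose (2 * k)) * 2 ^ k * int (odd_double_fact k))"
proof -
  have "id \<in> carrier (L_interval n)"
    by (simp add: carrier_L_interval id_in_signed_involutions)
  from L.mobius_eq_newton[OF this id_least all_sign_changes_in_carrier]
  have "real_of_int (mobius (L_interval n) id (all_sign_changes n))
      = L.newton n (all_sign_changes n) (- 2)" .
  also have "\<dots> = poly (L.newton_poly n (all_sign_changes n)) (- 1)"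
    by (simp add: L.poly_newton_poly)
  also have "\<dots> = poly (zeta_polynomial (L_interval n)) (- 1)"
    by (rule arg_cong[where f = "\<lambda>p. poly p (- 1)"], rule L.zeta_polynomial_eq_newton_poly[symmetric])
      (auto intro: all_sign_changes_in_carrier all_sign_changes_greatest)
  also have "\<dots> = (\<Sum>k=0..n div 2. (- 1) ^ n *
      (real (n choose (2 * k)) * 2 ^ k * real (odd_double_fact k)))"
    unfolding zeta_polynomial_L_interval poly_zeta_formula
  proof (rule sum.cong)
    fix k assume "k \<in> {0..n div 2}"
    then have "n = (n - k) + k" by auto
    \<comment> \<open>The sign \<open>(- 1) ^ k\<close> contained in \<open>(- 2) ^ k\<close>
      completes \<open>(- 1) ^ (n - k)\<close> to a sign independent of \<open>k\<close>.\<close>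
    then have "(- 1 :: real) ^ n = (- 1) ^ (n - k) * (- 1) ^ k" by (metis power_add)
    moreover have "(- 1 - 1 :: real) ^ k = (- 1) ^ k * 2 ^ k"
      by (simp add: power_mult_distrib[symmetric])
    ultimately show "real (n choose (2 * k)) * (- 1) ^ (n - k) * (- 1 - 1) ^ k * real (odd_double_fact k)
        = (- 1) ^ n * (real (n choose (2 * k)) * 2 ^ k * real (odd_double_fact k))"
      by (simp only: ac_simps)
  qed simp
  also have "\<dots> = real_of_int ((- 1) ^ n *
      (\<Sum>k=0..n div 2. int (n choose (2 * k)) * 2 ^ k * int (odd_double_fact k)))"
    by (simp add: sum_distrib_left)
  finally show ?thesis
    unfolding bottom_L_interval top_L_interval of_int_eq_iff .
qed

theorem proposition6p1:
  fixes n :: nat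
  assumes "n \<ge> 1"
  shows "Lattice.lattice (L_interval n) \<and>
    card (carrier (L_interval n)) =
           (\<Sum>k=0..n div 2. (n choose (2 * k)) * 2 ^ (n - k) * odd_double_fact k) \<and>
    (\<forall>r\<le>n. real (card {w \<in> carrier (L_interval n). abs_length n w = r}) =
           (\<Sum>k=0..min r (n - r). fact n / (fact k * fact (r - k) * fact (n - r - k)))) \<and>
    (\<forall>m::real. poly (zeta_polynomial (L_interval n)) m =
           (\<Sum>k=0..n div 2. real (n choose (2 * k)) * m ^ (n - k) * (m - 1) ^ k
              * real (odd_double_fact k))) \<and>
    card (maximal_chains (L_interval n)) =
           fact n * (\<Sum>k=0..n div 2. (n choose (2 * k)) * odd_double_fact k) \<and>
    mobius (L_interval n) \<bottom>\<^bsub>L_interval n\<^esub> \<top>\<^bsub>L_interval n\<^esub> =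
           (- 1) ^ n * (\<Sum>k=0..n div 2. int (n choose (2 * k)) * 2 ^ k * int (odd_double_fact k))"
  using lattice_L_interval card_carrier_formula card_rank_formula
    poly_zeta_formula[of n, folded zeta_polynomial_L_interval] card_maximal_chains_formula mobius_formula
  by blast

end
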